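(* Let $p$ be a prime number and let $d\ge 1$ be an integer. Then there does not exist any $\Sigma_p$-equivariant (continuous) map $$\operatorname{Conf}_p(\mathbb{R}^d)\longrightarrow S\big(W_p^{\oplus (d-1)}\big).$$
   Context: $\Sigma_p$ is the symmetric group on $p$ letters. $\operatorname{Conf}_p(\mathbb{R}^d)=\{(x_1,\dots,x_p)\in(\mathbb{R}^d)^p : x_i\neq x_j \text{ for } i\neq j\}$ is the ordered configuration space of $p$ distinct labeled points in $\mathbb{R}^d$, with $\Sigma_p$ acting by permuting the labels. $W_p=\{(v_1,\dots,v_p)\in\mathbb{R}^p : \sum_i v_i=0\}$ is the standard $\Sigma_p$-representation, with $\Sigma_p$ acting by permuting coordinates; $W_p^{\oplus(d-1)}$ carries the diagonal action. For a real orthogonal representation $V$, $S(V)=\{v\in V : \langle v,v\rangle=1\}$ is its unit sphere (empty if $V=0$). *)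

theory Defs
  imports
    "HOL-Analysis.Analysis"
    "HOL-Combinatorics.Permutations"
    "HOL-Computational_Algebra.Primes"
begin

text \<open>
  Since the dimensions \<open>d\<close> and \<open>d - 1\<close> occur together (and \<open>d - 1\<close> may be \<open>0\<close>), vectors and tuples
  are indexed by initial segments of \<^typ>\<open>nat\<close> starting at \<open>0\<close> and padded with zeros beyond them.
  The topology is the one induced from the product topology on functions; the lemma
  \<open>top_of_set_Rn\<close> says that on \<open>Rn d\<close> it is the Euclidean one.
\<close>

definition Rn :: "nat \<Rightarrow> (nat \<Rightarrow> real) set" where
  "Rn d = {x. \<forall>j\<ge>d. x j = 0}"

lemma top_of_set_Rn: "top_of_set (Rn d) = Euclidean_space d"
  by (simp add: Rn_def Euclidean_space_def euclidean_product_topology)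

definition tuples :: "nat \<Rightarrow> (nat \<Rightarrow> real) set \<Rightarrow> (nat \<Rightarrow> nat \<Rightarrow> real) set" where
  "tuples m V = {x. (\<forall>i<m. x i \<in> V) \<and> (\<forall>i\<ge>m. x i = (\<lambda>_. 0))}"

definition Conf :: "nat \<Rightarrow> nat \<Rightarrow> (nat \<Rightarrow> nat \<Rightarrow> real) set" where
  "Conf p d = {x \<in> tuples p (Rn d). \<forall>i<p. \<forall>j<p. i \<noteq> j \<longrightarrow> x i \<noteq> x j}"

definition W :: "nat \<Rightarrow> (nat \<Rightarrow> real) set" where
  "W p = {v \<in> Rn p. (\<Sum>i<p. v i) = 0}"

text \<open>
  An element \<open>v\<close> of the \<open>m\<close>-fold direct sum has summands \<open>v k \<in> W p\<close> for \<open>k < m\<close>: the first index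
  selects the summand and the second one the coordinate in \<open>\<real>\<^sup>p\<close>, on which the symmetric group acts.
\<close>

definition W_sum :: "nat \<Rightarrow> nat \<Rightarrow> (nat \<Rightarrow> nat \<Rightarrow> real) set" where
  "W_sum p m = tuples m (W p)"

definition W_inner :: "nat \<Rightarrow> nat \<Rightarrow> (nat \<Rightarrow> nat \<Rightarrow> real) \<Rightarrow> (nat \<Rightarrow> nat \<Rightarrow> real) \<Rightarrow> real" where
  "W_inner p m v w = (\<Sum>k<m. \<Sum>i<p. v k i * w k i)"

definition W_sphere :: "nat \<Rightarrow> nat \<Rightarrow> (nat \<Rightarrow> nat \<Rightarrow> real) set" where
  "W_sphere p m = {v \<in> W_sum p m. W_inner p m v v = 1}"

text \<open>The left action \<open>(\<sigma> \<cdot> x)\<^sub>i = x\<^bsub>\<sigma>\<^sup>-\<^sup>1(i)\<^esub>\<close>, for \<open>\<sigma>\<close> with \<open>\<sigma> permutes {..<p}\<close>.\<close>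

definition perm_act :: "(nat \<Rightarrow> nat) \<Rightarrow> (nat \<Rightarrow> 'a) \<Rightarrow> nat \<Rightarrow> 'a" where
  "perm_act \<sigma> x = (\<lambda>i. x (inv \<sigma> i))"

definition diag_act :: "(nat \<Rightarrow> nat) \<Rightarrow> (nat \<Rightarrow> nat \<Rightarrow> 'a) \<Rightarrow> nat \<Rightarrow> nat \<Rightarrow> 'a" where
  "diag_act \<sigma> v = (\<lambda>k. perm_act \<sigma> (v k))"

definition equivariant_map :: "nat \<Rightarrow> nat \<Rightarrow> ((nat \<Rightarrow> nat \<Rightarrow> real) \<Rightarrow> nat \<Rightarrow> nat \<Rightarrow> real) \<Rightarrow> bool" where
  "equivariant_map p d f \<longleftrightarrow>
     continuous_on (Conf p d) f \<and>
     f \<in> Conf p d \<rightarrow> W_sphere p (d - 1) \<and>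
     (\<forall>\<sigma>. \<sigma> permutes {..<p} \<longrightarrow>
        (\<forall>x\<in>Conf p d. f (perm_act \<sigma> x) = diag_act \<sigma> (f x)))"

end

theory Submission
  imports Defs "HOL-Homology.Simplices" "HOL-Number_Theory.Cong"
begin

text \<open>
  Only the cyclic group \<open>\<int>/p\<close> rotating the labels matters. Suppose \<open>f\<close> is equivariant. Multiplied by the
  product of the pairwise distances, \<open>f\<close> extends by \<open>0\<close> to all \<open>p\<close>-tuples of points in \<open>\<real>\<^sup>d\<close> and vanishes
  exactly at the tuples with a coincidence. At these, clustering the points at growing scales gives a
  chain of nontrivial partitions of the labels. As \<open>p\<close> is prime, \<open>\<int>/p\<close> acts freely on nontrivial
  partitions, so that a label can be attached to each of them equivariantly; weighting these labels
  defines an equivariant map to \<open>\<real>\<^sup>p\<close> that has at most \<open>p - 2\<close> nonzero coordinates and does not vanish at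
  nonconstant tuples with a coincidence. Both maps together would send the nonconstant \<open>p\<close>-tuples,
  homotopically a sphere of dimension \<open>N = d (p - 1) - 1\<close>, to a free \<open>\<int>/p\<close>-complex of dimension \<open>N - 1\<close>.

  This contradicts Dold's theorem: the sphere carries chains \<open>b\<^sub>0, \<dots>, b\<^sub>N\<close> forming an initial piece of
  the periodic resolution of \<open>\<int>/p\<close>. The generators of \<open>H\<^sup>k(B\<int>/p; \<int>/p)\<close> are represented by explicit cochains
  on the complex, and evaluate to \<open>1\<close> modulo \<open>p\<close> on the image of a fine subdivision of \<open>b\<^sub>k\<close>, by induction
  on \<open>k\<close>. But the value for \<open>k = N\<close> is \<open>0\<close>, because the complex has no simplices of dimension \<open>N\<close>.
\<close>

subsection \<open>Alternating sums and subdivisions\<close>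

text \<open>The augmented simplicial coboundary of the cochain \<open>h\<close>, evaluated at the
  simplex with vertices \<open>xs\<close>. The recursion splits off the face opposite the first
  vertex.\<close>

primrec alt :: "('a list \<Rightarrow> int) \<Rightarrow> 'a list \<Rightarrow> int" where
  "alt h [] = 0"
| "alt h (x # xs) = h xs - alt (\<lambda>ys. h (x # ys)) xs"

lemma alt_conv_sum:
  "alt h xs = (\<Sum>i<length xs. (-1) ^ i * h (take i xs @ drop (Suc i) xs))"
proof (induction xs arbitrary: h)
  case (Cons x xs)
  then show ?case
    by (simp add: sum.lessThan_Suc_shift sum_negf del: sum.lessThan_Suc)
qed simp

lemma alt_diff: "alt (\<lambda>ys. f ys - g ys) xs = alt f xs - alt g xs"
  by (induction xs arbitrary: f g) simp_all

lemma alt_mult: "alt (\<lambda>ys. c * f ys) xs = c * alt f xs"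
  by (induction xs arbitrary: f) (simp_all add: right_diff_distrib)

lemma alt_zero [simp]: "alt (\<lambda>ys. 0) xs = 0"
  by (induction xs) simp_all

lemma alt_cong_mod:
  assumes "\<And>ys. set ys \<subseteq> set xs \<Longrightarrow> Suc (length ys) = length xs \<Longrightarrow> [f ys = g ys] (mod q)"
  shows "[alt f xs = alt g xs] (mod q)"
  using assms
proof (induction xs arbitrary: f g)
  case (Cons x xs)
  have "[f xs = g xs] (mod q)"
    by (rule Cons.prems) auto
  moreover have "[alt (\<lambda>ys. f (x # ys)) xs = alt (\<lambda>ys. g (x # ys)) xs] (mod q)"
    by (rule Cons.IH, rule Cons.prems) auto
  ultimately show ?case
    by (auto intro: cong_diff)
qed simp

lemma alt_cong:
  assumes "\<And>ys. set ys \<subseteq> set xs \<Longrightarrow> Suc (length ys) = length xs \<Longrightarrow> f ys = g ys"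
  shows "alt f xs = alt g xs"
  using alt_cong_mod[of xs f g 0] assms by simp

lemma alt_map: "alt h (map f xs) = alt (\<lambda>ys. h (map f ys)) xs"
  by (induction xs arbitrary: h) simp_all

lemma alt_alt: "alt (alt h) xs = 0"
proof (induction xs arbitrary: h)
  case (Cons x xs)
  then show ?case by (simp add: alt_diff)
qed simp

text \<open>The value of the cochain \<open>w\<close> on the barycentric subdivision of the simplex with vertices \<open>Bs\<close>, where a
  face is represented by the union of its vertices, and read off through \<open>\<gamma>\<close>.\<close>

primrec sd_eval :: "('b set \<Rightarrow> int) \<Rightarrow> nat \<Rightarrow> (int list \<Rightarrow> int) \<Rightarrow> 'b set list \<Rightarrow> int" where
  "sd_eval \<gamma> 0 w Bs = w []"
| "sd_eval \<gamma> (Suc n) w Bs = alt (sd_eval \<gamma> n (\<lambda>gs. w (\<gamma> (\<Union> (set Bs)) # gs))) Bs"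

lemma sd_eval_diff: "sd_eval \<gamma> n (\<lambda>gs. v gs - w gs) Bs = sd_eval \<gamma> n v Bs - sd_eval \<gamma> n w Bs"
proof (induction n arbitrary: v w Bs)
  case (Suc n)
  have "sd_eval \<gamma> n (\<lambda>gs. v gs - w gs) = (\<lambda>Bs. sd_eval \<gamma> n v Bs - sd_eval \<gamma> n w Bs)" for v w
    by (rule ext) (rule Suc.IH)
  then show ?case
    by (simp only: sd_eval.simps alt_diff)
qed simp

lemma sd_eval_mult: "sd_eval \<gamma> n (\<lambda>gs. k * w gs) Bs = k * sd_eval \<gamma> n w Bs"
proof (induction n arbitrary: w Bs)
  case (Suc n)
  have "sd_eval \<gamma> n (\<lambda>gs. k * w gs) = (\<lambda>Bs. k * sd_eval \<gamma> n w Bs)" for w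
    by (rule ext) (rule Suc.IH)
  then show ?case
    by (simp only: sd_eval.simps alt_mult)
qed simp

lemma sd_eval_zero [simp]: "sd_eval \<gamma> n (\<lambda>gs. 0) = (\<lambda>Bs. 0)"
  by (induction n) auto

text \<open>Subdivision is a chain map. Coning with the barycentre turns \<open>alt w\<close> into
  \<open>w\<close> minus the coboundary of the coned cochain; by induction the latter contributes a
  double coboundary, which vanishes.\<close>

lemma sd_eval_alt:
  "length Bs = Suc n \<Longrightarrow> sd_eval \<gamma> (Suc n) (alt w) Bs = alt (sd_eval \<gamma> n w) Bs"
proof (induction n arbitrary: w Bs)
  case 0
  then obtain B where "Bs = [B]"
    by (auto simp: length_Suc_conv)
  then show ?case by simp
next
  case (Suc n)
  let ?g = "\<gamma> (\<Union> (set Bs))"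
  have "sd_eval \<gamma> (Suc (Suc n)) (alt w) Bs
      = alt (\<lambda>Cs. sd_eval \<gamma> (Suc n) w Cs - sd_eval \<gamma> (Suc n) (alt (\<lambda>gs. w (?g # gs))) Cs) Bs"
    by (simp only: sd_eval.simps(2)[of _ "Suc n"] alt.simps sd_eval_diff[abs_def])
  also have "\<dots> = alt (sd_eval \<gamma> (Suc n) w) Bs
      - alt (sd_eval \<gamma> (Suc n) (alt (\<lambda>gs. w (?g # gs)))) Bs"
    by (rule alt_diff)
  also have "alt (sd_eval \<gamma> (Suc n) (alt (\<lambda>gs. w (?g # gs)))) Bs
      = alt (alt (sd_eval \<gamma> n (\<lambda>gs. w (?g # gs)))) Bs"
    using Suc.prems by (intro alt_cong Suc.IH) simp
  finally show ?case
    by (simp only: alt_alt diff_zero)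
qed

lemma sd_eval_cong_mod:
  assumes "length Bs = n"
    and "\<And>gs hs. length gs = n \<Longrightarrow> list_all2 R gs hs \<Longrightarrow> [v gs = w hs] (mod q)"
    and "\<And>Cs. Cs \<noteq> [] \<Longrightarrow> set Cs \<subseteq> set Bs \<Longrightarrow> R (\<gamma> (\<Union> (set Cs))) (\<gamma>' (\<Union> (set Cs)))"
  shows "[sd_eval \<gamma> n v Bs = sd_eval \<gamma>' n w Bs] (mod q)"
  using assms
proof (induction n arbitrary: v w Bs)
  case (Suc n)
  show ?case
    unfolding sd_eval.simps
  proof (rule alt_cong_mod)
    fix Cs assume Cs: "set Cs \<subseteq> set Bs" "Suc (length Cs) = length Bs"
    have "R (\<gamma> (\<Union> (set Bs))) (\<gamma>' (\<Union> (set Bs)))"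
      using Suc.prems(1) by (intro Suc.prems(3)) auto
    then show "[sd_eval \<gamma> n (\<lambda>gs. v (\<gamma> (\<Union> (set Bs)) # gs)) Cs
        = sd_eval \<gamma>' n (\<lambda>gs. w (\<gamma>' (\<Union> (set Bs)) # gs)) Cs] (mod q)"
      using Cs Suc.prems by (intro Suc.IH) auto
  qed
qed simp

lemma sd_eval_map_image:
  "sd_eval \<gamma> n w (map ((`) \<tau>) Bs) = sd_eval (\<lambda>B. \<gamma> (\<tau> ` B)) n w Bs"
proof (induction n arbitrary: w Bs)
  case (Suc n)
  have "\<Union> (set (map ((`) \<tau>) Bs)) = \<tau> ` \<Union> (set Bs)"
    by auto
  then show ?case
    by (simp only: sd_eval.simps alt_map Suc.IH)
qed simp

text \<open>A flag of \<open>n\<close> faces on fewer than \<open>n\<close> elements must repeat a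
  union: a face either loses an element, and induction applies, or has the full union, and then two
  adjacent labels agree.\<close>

lemma sd_eval_eq_0:
  assumes "length Bs = n" "\<And>B. B \<in> set Bs \<Longrightarrow> B \<noteq> {}"
    and "finite (\<Union> (set Bs))" "card (\<Union> (set Bs)) < n"
    and "\<And>gs. \<not> distinct_adj gs \<Longrightarrow> w gs = 0"
  shows "sd_eval \<gamma> n w Bs = 0"
  using assms
proof (induction n arbitrary: w Bs)
  case (Suc n)
  let ?U = "\<Union> (set Bs)"
  let ?w = "\<lambda>gs. w (\<gamma> ?U # gs)"
  have "sd_eval \<gamma> n ?w Cs = 0" if Cs: "set Cs \<subseteq> set Bs" "Suc (length Cs) = length Bs" for Cs
  proof (cases "card (\<Union> (set Cs)) < n")
    case True
    show ?thesis
    proof (rule Suc.IH)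
      show "finite (\<Union> (set Cs))"
        using Suc.prems(3) by (rule finite_subset[rotated]) (use Cs in auto)
      show "w (\<gamma> ?U # gs) = 0" if "\<not> distinct_adj gs" for gs
        using that by (intro Suc.prems(5)) (auto simp: distinct_adj_Cons)
    qed (use Cs Suc.prems True in auto)
  next
    case False
    have "\<Union> (set Cs) = ?U"
      using False Cs(1) Suc.prems(3,4) by (intro card_seteq) auto
    moreover obtain m where "n = Suc m"
    proof (cases n)
      case 0
      with Suc.prems obtain B where "Bs = [B]"
        by (auto simp: length_Suc_conv)
      with Suc.prems 0 show ?thesis by auto
    qed
    moreover have "w (\<gamma> ?U # \<gamma> ?U # gs) = 0" for gs
      by (rule Suc.prems(5)) simp
    ultimately show ?thesis
      by simp
  qed
  then have "alt (sd_eval \<gamma> n ?w) Bs = alt (\<lambda>_. 0) Bs"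
    by (rule alt_cong)
  then show ?case
    by simp
qed auto

subsection \<open>Cochains of the cyclic group\<close>

text \<open>
  The cochains \<open>cup_bock q (\<lambda>_. 1)\<close> represent the generators of the cohomology of \<open>B\<int>/q\<close> in the bar
  complex: \<open>bock\<close> is the Bockstein of the tautological class \<open>(a, b) \<mapsto> b - a\<close>, and the cochain in degree \<open>k\<close>
  is its power times the tautological class if \<open>k\<close> is odd. In even degrees, the last label may be
  weighted by \<open>f\<close>; with \<open>f\<close> the identity, this is a primitive modulo \<open>q\<close> of the next class.
\<close>

definition bock :: "int \<Rightarrow> int \<Rightarrow> int \<Rightarrow> int \<Rightarrow> int" where
  "bock q a b c = ((b - a) mod q + (c - b) mod q - (c - a) mod q) div q"

fun cup_bock :: "int \<Rightarrow> (int \<Rightarrow> int) \<Rightarrow> int list \<Rightarrow> int" where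
  "cup_bock q f [] = 0"
| "cup_bock q f [a] = f a"
| "cup_bock q f [a, b] = (b - a) mod q"
| "cup_bock q f (a # b # c # r) = bock q a b c * cup_bock q f (c # r)"

text \<open>The division in \<open>bock\<close> is exact: modulo \<open>q\<close> the three residues
  are differences that cancel.\<close>

lemma bock_mult: "q * bock q a b c = (b - a) mod q + (c - b) mod q - (c - a) mod q"
proof -
  have "[(b - a) mod q + (c - b) mod q - (c - a) mod q = (b - a) + (c - b) - (c - a)] (mod q)"
    by (intro cong_diff cong_add) (simp_all add: cong_def)
  then show ?thesis
    by (simp add: bock_def cong_0_iff)
qed

text \<open>\<open>q * bock\<close> is the coboundary of the cochain \<open>(b - a) mod q\<close>,
  hence closed, and \<open>q\<close> can be cancelled.\<close>

lemma bock_cocycle: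
  assumes "q \<noteq> 0"
  shows "bock q b c d - bock q a c d + bock q a b d - bock q a b c = 0"
proof -
  have "q * (bock q b c d - bock q a c d + bock q a b d - bock q a b c) = 0"
    by (simp add: algebra_simps bock_mult)
  with assms show ?thesis by simp
qed

text \<open>The Leibniz rule for the product with \<open>bock\<close>, a cocycle of even degree, so
  that no sign appears.\<close>

lemma alt_cup_bock_step:
  assumes "q \<noteq> 0"
  shows "alt (cup_bock q f) (a # b # c # d # r) = bock q a b c * alt (cup_bock q f) (c # d # r)"
proof -
  have "alt (cup_bock q f) (a # b # c # d # r) =
      (bock q b c d - bock q a c d + bock q a b d - bock q a b c) * cup_bock q f (d # r)
      + bock q a b c * (cup_bock q f (d # r) - alt (\<lambda>ys. cup_bock q f (c # ys)) (d # r))"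
    by (simp add: algebra_simps alt_mult)
  then show ?thesis
    using bock_cocycle[OF assms] by simp
qed

text \<open>The tautological class has coboundary \<open>q * bock\<close>, and the
  \<open>bock\<close> factors are cocycles. At length 1 the augmented coboundary is 0, while the
  right-hand side is \<open>q\<close>.\<close>

lemma alt_cup_bock_odd:
  "q \<noteq> 0 \<Longrightarrow> odd (length gs) \<Longrightarrow> length gs \<noteq> 1 \<Longrightarrow>
    alt (cup_bock q (\<lambda>_. 1)) gs = q * cup_bock q (\<lambda>_. 1) gs"
proof (induction q "\<lambda>_::int. 1::int" gs rule: cup_bock.induct)
  case (4 q a b c r)
  show ?case
  proof (cases r)
    case Nil
    then show ?thesis by (simp add: bock_mult)
  next
    case (Cons d r')
    with 4 show ?thesis
      by (simp del: alt.simps add: alt_cup_bock_step)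
  qed
qed auto

lemma alt_cup_bock_id:
  "q \<noteq> 0 \<Longrightarrow> even (length gs) \<Longrightarrow> [alt (cup_bock q (\<lambda>a. a)) gs = cup_bock q (\<lambda>_. 1) gs] (mod q)"
proof (induction q "\<lambda>_::int. 1::int" gs rule: cup_bock.induct)
  case (4 q a b c r)
  then obtain d r' where "r = d # r'" by (cases r) auto
  with 4 show ?case
    by (simp del: alt.simps add: alt_cup_bock_step cong_scalar_left)
qed (auto simp: cong_def)

text \<open>The cochains are normalised: \<open>bock\<close> vanishes as soon as two neighbouring
  arguments agree.\<close>

lemma cup_bock_not_distinct_adj: "\<not> distinct_adj gs \<Longrightarrow> cup_bock q f gs = 0"
  by (induction q f gs rule: cup_bock.induct) (auto simp: bock_def)

lemma bock_shift:
  assumes "[a' = a + 1] (mod q)" "[b' = b + 1] (mod q)" "[c' = c + 1] (mod q)"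
  shows "bock q a' b' c' = bock q a b c"
proof -
  have "(y' - x') mod q = (y - x) mod q" if "[x' = x + 1] (mod q)" "[y' = y + 1] (mod q)" for x x' y y'
    using cong_diff[OF that(2,1)] by (simp add: cong_def)
  with assms show ?thesis by (simp add: bock_def)
qed

lemma cup_bock_shift:
  "list_all2 (\<lambda>a b. [b = a + 1] (mod q)) gs hs \<Longrightarrow> cup_bock q (\<lambda>_. 1) hs = cup_bock q (\<lambda>_. 1) gs"
proof (induction q "\<lambda>_::int. 1::int" gs arbitrary: hs rule: cup_bock.induct)
  case (3 q a b)
  then obtain a' b' where hs: "hs = [a', b']" "[a' = a + 1] (mod q)" "[b' = b + 1] (mod q)"
    by (auto simp: list_all2_Cons1)
  show ?case
    using cong_diff[OF hs(3,2)] by (simp add: hs(1) cong_def)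
next
  case (4 q a b c r)
  then show ?case
    by (auto simp: list_all2_Cons1 bock_shift)
qed (auto simp: list_all2_Cons1)

text \<open>In odd length all factors but the last depend only on differences of labels, and the
  last one, the weight, grows by 1.\<close>

lemma cup_bock_id_shift:
  "list_all2 (\<lambda>a b. [b = a + 1] (mod q)) gs hs \<Longrightarrow> odd (length gs) \<Longrightarrow>
    [cup_bock q (\<lambda>a. a) hs - cup_bock q (\<lambda>a. a) gs = cup_bock q (\<lambda>_. 1) gs] (mod q)"
proof (induction q "\<lambda>a::int. a" gs arbitrary: hs rule: cup_bock.induct)
  case (2 q a)
  then obtain a' where a': "hs = [a']" "[a' = a + 1] (mod q)"
    by (auto simp: list_all2_Cons1)
  show ?case
    using cong_diff[OF a'(2) cong_refl[of a]] a'(1) by simp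
next
  case (4 q a b c r)
  then obtain a' b' hs' where hs: "hs = a' # b' # hs'"
      and ab: "[a' = a + 1] (mod q)" "[b' = b + 1] (mod q)"
      and hs': "list_all2 (\<lambda>a b. [b = a + 1] (mod q)) (c # r) hs'"
    by (auto simp: list_all2_Cons1)
  then obtain c' s where c': "hs' = c' # s" "[c' = c + 1] (mod q)"
    by (auto simp: list_all2_Cons1)
  show ?case
    using cong_scalar_left[OF 4(1)[OF hs'], of "bock q a b c"] 4(3) hs c' bock_shift[OF ab c'(2)]
    by (simp add: right_diff_distrib)
qed (auto simp: list_all2_Cons1)

subsection \<open>Evaluation of singular chains on labels\<close>

text \<open>The integers appear as the free abelian group on the single generator \<open>()\<close>,
  so that additivity is inherited from \<open>frag_extend\<close>.\<close>

definition frag_eval :: "('a \<Rightarrow> int) \<Rightarrow> ('a \<Rightarrow>\<^sub>0 int) \<Rightarrow> int" where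
  "frag_eval h c = Poly_Mapping.lookup (frag_extend (\<lambda>x. frag_cmul (h x) (frag_of ())) c) ()"

lemma frag_eval_0 [simp]: "frag_eval h 0 = 0"
  by (simp add: frag_eval_def)

lemma frag_eval_of [simp]: "frag_eval h (frag_of x) = h x"
  by (simp add: frag_eval_def)

lemma frag_eval_diff: "frag_eval h (a - b) = frag_eval h a - frag_eval h b"
  by (simp add: frag_eval_def frag_extend_diff lookup_minus)

lemma frag_eval_add: "frag_eval h (a + b) = frag_eval h a + frag_eval h b"
  by (simp add: frag_eval_def frag_extend_add lookup_add)

lemma frag_eval_cmul: "frag_eval h (frag_cmul k a) = k * frag_eval h a"
  by (simp add: frag_eval_def frag_extend_cmul)

lemma frag_eval_sum: "frag_eval h (sum f I) = (\<Sum>i\<in>I. frag_eval h (f i))"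
  by (induction I rule: infinite_finite_induct) (simp_all add: frag_eval_add)

lemma frag_eval_cong_mod:
  assumes "\<And>x. x \<in> Poly_Mapping.keys c \<Longrightarrow> [f x = g x] (mod q)"
  shows "[frag_eval f c = frag_eval g c] (mod q)"
proof -
  have "Poly_Mapping.keys c \<subseteq> {x. [f x = g x] (mod q)}"
    using assms by auto
  then show ?thesis
    by (induction c rule: frag_induction) (auto simp: frag_eval_diff intro: cong_diff)
qed

lemma frag_eval_cong:
  "(\<And>x. x \<in> Poly_Mapping.keys c \<Longrightarrow> f x = g x) \<Longrightarrow> frag_eval f c = frag_eval g c"
  using frag_eval_cong_mod[of c f g 0] by simp

lemma frag_eval_fun_diff: "frag_eval (\<lambda>x. f x - g x) c = frag_eval f c - frag_eval g c"
  using subset_UNIV by (induction c rule: frag_induction) (auto simp: frag_eval_diff)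

lemma frag_eval_fun_mult: "frag_eval (\<lambda>x. k * f x) c = k * frag_eval f c"
  using subset_UNIV by (induction c rule: frag_induction) (auto simp: frag_eval_diff right_diff_distrib)

lemma frag_eval_chain_map: "frag_eval h (chain_map k g c) = frag_eval (\<lambda>\<sigma>. h (simplex_map k g \<sigma>)) c"
  using subset_UNIV by (induction c rule: frag_induction) (auto simp: frag_eval_diff chain_map_diff)

lemma keys_chain_map: "Poly_Mapping.keys (chain_map k g c) \<subseteq> simplex_map k g ` Poly_Mapping.keys c"
  unfolding chain_map_def using keys_frag_extend[of "frag_of \<circ> simplex_map k g" c] by fastforce

section \<open>Evaluation at the vertices of singular simplices\<close>

definition verts :: "nat \<Rightarrow> ((nat \<Rightarrow> real) \<Rightarrow> 'a) \<Rightarrow> 'a list" where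
  "verts k \<sigma> = map (\<lambda>i. simplicial_vertex i \<sigma>) [0..<Suc k]"

lemma length_verts [simp]: "length (verts k \<sigma>) = Suc k"
  by (simp add: verts_def)

lemma verts_simplex_map: "verts k (simplex_map k g \<sigma>) = map g (verts k \<sigma>)"
  by (auto simp: verts_def simplicial_vertex_def simplex_map_def)

lemma set_verts: "set (verts k \<sigma>) \<subseteq> \<sigma> ` standard_simplex k"
  by (auto simp: verts_def simplicial_vertex_def)

lemma verts_singular_face:
  assumes "j \<le> Suc k"
  shows "verts k (singular_face (Suc k) j \<sigma>) = take j (verts (Suc k) \<sigma>) @ drop (Suc j) (verts (Suc k) \<sigma>)"
proof (rule nth_equalityI)
  fix i assume "i < length (verts k (singular_face (Suc k) j \<sigma>))"
  then have i: "i \<le> k" by simp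
  have *: "simplical_face j (\<lambda>m. if m = i then 1 else 0) = (\<lambda>m. if m = (if i < j then i else Suc i) then 1 else (0::real))"
    by (auto simp: simplical_face_def fun_eq_iff)
  show "verts k (singular_face (Suc k) j \<sigma>) ! i = (take j (verts (Suc k) \<sigma>) @ drop (Suc j) (verts (Suc k) \<sigma>)) ! i"
    using assms i
    by (auto simp del: upt_Suc simp: verts_def simplicial_vertex_def singular_face_def nth_append * Suc_diff_Suc)
qed (use assms in simp)

text \<open>The singular simplex is replaced by the subdivided simplex whose vertices are the label
  sets \<open>A v\<close>; a face takes the union of these sets, which \<open>\<gamma>\<close> turns
  into one integer label.\<close>

definition simplex_eval ::
  "('a \<Rightarrow> 'b set) \<Rightarrow> ('b set \<Rightarrow> int) \<Rightarrow> (int list \<Rightarrow> int) \<Rightarrow> nat \<Rightarrow> ((nat \<Rightarrow> real) \<Rightarrow> 'a) \<Rightarrow> int"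
  where "simplex_eval A \<gamma> w k \<sigma> = sd_eval \<gamma> (Suc k) w (map A (verts k \<sigma>))"

text \<open>Stokes' formula: the faces of a singular simplex correspond to the faces of its vertex
  list, and \<open>sd_eval_alt\<close> moves the coboundary past the subdivision.\<close>

lemma frag_eval_chain_boundary:
  "frag_eval (simplex_eval A \<gamma> w k) (chain_boundary (Suc k) c)
    = frag_eval (simplex_eval A \<gamma> (alt w) (Suc k)) c"
proof -
  have eq: "simplex_eval A \<gamma> (alt w) (Suc k) \<sigma>
      = (\<Sum>j\<le>Suc k. (-1) ^ j * simplex_eval A \<gamma> w k (singular_face (Suc k) j \<sigma>))" for \<sigma>
    unfolding simplex_eval_def
    by (subst sd_eval_alt)
       (auto simp del: sd_eval.simps sum.lessThan_Suc sum.atMost_Suc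
          simp: alt_conv_sum verts_singular_face take_map drop_map lessThan_Suc_atMost intro!: sum.cong)
  show ?thesis
    using subset_UNIV
    by (induction c rule: frag_induction)
       (auto simp del: sum.atMost_Suc simp: eq chain_boundary_of frag_eval_sum frag_eval_cmul chain_boundary_diff frag_eval_diff)
qed

section \<open>Iterated subdivision of singular chains\<close>

lemma chain_boundary_iterated_subdivision:
  "singular_chain p X c \<Longrightarrow> chain_boundary p ((singular_subdivision p ^^ m) c)
    = (singular_subdivision (p - Suc 0) ^^ m) (chain_boundary p c) \<and>
    singular_chain p X ((singular_subdivision p ^^ m) c)"
  by (induction m) (simp_all add: chain_boundary_singular_subdivision[of _ X] singular_chain_singular_subdivision)

lemma naturality_iterated_subdivision:
  "singular_chain p X c \<Longrightarrow> (singular_subdivision p ^^ m) (chain_map p g c)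
    = chain_map p g ((singular_subdivision p ^^ m) c)"
  by (induction m)
     (simp_all add: naturality_singular_subdivision[of _ X] chain_boundary_iterated_subdivision)

lemma singular_subdivision_sum:
  "singular_subdivision p (sum f I) = (\<Sum>i\<in>I. singular_subdivision p (f i))"
  by (induction I rule: infinite_finite_induct) (simp_all add: singular_subdivision_add)

lemma iterated_subdivision_sum:
  "(singular_subdivision p ^^ m) (sum f I) = (\<Sum>i\<in>I. (singular_subdivision p ^^ m) (f i))"
  by (induction m arbitrary: f) (simp_all add: singular_subdivision_sum)

lemma iterated_subdivision_zero:
  "singular_chain 0 X c \<Longrightarrow> (singular_subdivision 0 ^^ m) c = c"
  by (induction m) (simp_all add: singular_subdivision_zero[of X])

lemma singular_chain_chain_map_pow:
  assumes "continuous_map X X t" "singular_chain k X c"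
  shows "singular_chain k X ((chain_map k t ^^ i) c)"
  by (induction i) (auto simp: assms intro: singular_chain_chain_map[where X = X])

lemma naturality_iterated_subdivision_pow:
  assumes "continuous_map X X t" "singular_chain k X c"
  shows "(singular_subdivision k ^^ m) ((chain_map k t ^^ i) c)
    = (chain_map k t ^^ i) ((singular_subdivision k ^^ m) c)"
  by (induction i)
     (simp_all add: naturality_iterated_subdivision[of _ X] singular_chain_chain_map_pow[OF assms])

text \<open>The differentials \<open>t - 1\<close> and \<open>1 + t + \<dots> + t\<^bsup>p-1\<^esup>\<close> of the periodic resolution, acting on \<open>k\<close>-chains.\<close>

definition periodic_boundary :: "nat \<Rightarrow> ('a \<Rightarrow> 'a) \<Rightarrow> nat \<Rightarrow> 'a chain \<Rightarrow> 'a chain" where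
  "periodic_boundary p t k c =
    (if even k then chain_map k t c - c else \<Sum>i<p. (chain_map k t ^^ i) c)"

text \<open>Dold's obstruction. By \<open>A_open\<close>, finely subdivided simplices have all
  vertex labels in one \<open>A x\<close>, where the classes \<open>cup_bock\<close> can be
  evaluated. The boundary relations carry the value 1 modulo \<open>p\<close> from
  \<open>b 0\<close> up to \<open>b N\<close>, but \<open>Suc N\<close> vertices with at most
  \<open>N\<close> labels give the value 0.\<close>

theorem no_small_equivariant_labelling:
  fixes X :: "'a topology" and b :: "nat \<Rightarrow> 'a chain" and A :: "'a \<Rightarrow> 'b set" and \<gamma> :: "'b set \<Rightarrow> int"
  assumes "1 < p" and t: "continuous_map X X t"
    and b: "\<And>k. k \<le> N \<Longrightarrow> singular_chain k X (b k)"
    and b_0: "b 0 = frag_of \<sigma>\<^sub>0"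
    and b_Suc: "\<And>k. k < N \<Longrightarrow> chain_boundary (Suc k) (b (Suc k)) = periodic_boundary p t k (b k)"
    and A_open: "\<And>x. x \<in> topspace X \<Longrightarrow> openin X {y \<in> topspace X. A y \<subseteq> A x}"
    and A_fin: "\<And>x. x \<in> topspace X \<Longrightarrow> finite (A x) \<and> A x \<noteq> {} \<and> card (A x) \<le> N"
    and A_t: "\<And>x. x \<in> topspace X \<Longrightarrow> A (t x) = \<tau> ` A x"
    and \<gamma>: "\<And>x B. x \<in> topspace X \<Longrightarrow> B \<subseteq> A x \<Longrightarrow> B \<noteq> {} \<Longrightarrow> [\<gamma> (\<tau> ` B) = \<gamma> B + 1] (mod int p)"
  shows False
proof -
  define \<C> where "\<C> = (\<lambda>x. {y \<in> topspace X. A y \<subseteq> A x}) ` topspace X"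
  have "\<exists>n. \<forall>m\<ge>n. \<forall>f\<in>Poly_Mapping.keys ((singular_subdivision k ^^ m) (b k)).
      \<exists>V\<in>\<C>. f \<in> standard_simplex k \<rightarrow> V" if "k \<le> N" for k
  proof (rule sufficient_iterated_singular_subdivision_exists[of \<C> X k "b k"])
    show "openin X U" if "U \<in> \<C>" for U
      using that A_open by (auto simp: \<C>_def)
    show "topspace X \<subseteq> \<Union>\<C>"
      by (auto simp: \<C>_def)
  qed (use b that in blast)+
  then obtain n where n: "\<And>k m f. k \<le> N \<Longrightarrow> n k \<le> m \<Longrightarrow>
      f \<in> Poly_Mapping.keys ((singular_subdivision k ^^ m) (b k)) \<Longrightarrow> \<exists>V\<in>\<C>. f \<in> standard_simplex k \<rightarrow> V"
    by metis
  \<comment> \<open>One number of subdivisions serves all degrees, so that the boundary relations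
    between the \<open>b k\<close> pass to the \<open>c k\<close>.\<close>
  define m where "m = Max (n ` {..N})"
  have n_m: "n k \<le> m" if "k \<le> N" for k
    using that by (simp add: m_def)
  define c where "c k = (singular_subdivision k ^^ m) (b k)" for k
  define small where "small k = {\<sigma>. \<exists>x\<in>topspace X. \<forall>v\<in>set (verts k \<sigma>). v \<in> topspace X \<and> A v \<subseteq> A x}" for k
  have c_small: "Poly_Mapping.keys (c k) \<subseteq> small k" if kN: "k \<le> N" for k
  proof
    fix \<sigma> assume "\<sigma> \<in> Poly_Mapping.keys (c k)"
    then obtain V where "V \<in> \<C>" "\<sigma> \<in> standard_simplex k \<rightarrow> V"
      using n[OF kN n_m[OF kN]] by (auto simp: c_def)
    then show "\<sigma> \<in> small k"
      using set_verts[of k \<sigma>] by (fastforce simp: small_def \<C>_def)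
  qed
  have c_chain: "singular_chain k X (c k)" if "k \<le> N" for k
    using b[OF that] by (simp add: c_def chain_boundary_iterated_subdivision)
  have c_0: "c 0 = frag_of \<sigma>\<^sub>0"
    using iterated_subdivision_zero[OF b[of 0]] by (simp add: c_def b_0)
  have c_Suc: "chain_boundary (Suc k) (c (Suc k)) = periodic_boundary p t k (c k)" if "k < N" for k
  proof -
    have "chain_boundary (Suc k) (c (Suc k)) = (singular_subdivision k ^^ m) (periodic_boundary p t k (b k))"
      using chain_boundary_iterated_subdivision[OF b[of "Suc k"]] that by (simp add: c_def b_Suc)
    also have "\<dots> = periodic_boundary p t k (c k)"
      using b[of k] that t
      by (simp add: periodic_boundary_def c_def singular_subdivision_power_diff
          iterated_subdivision_sum naturality_iterated_subdivision[of _ X] naturality_iterated_subdivision_pow[of X])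
    finally show ?thesis .
  qed
  let ?q = "int p"
  define E where "E f k = frag_eval (simplex_eval A \<gamma> (cup_bock ?q f) k)" for f k
  have small_t: "simplex_map k t \<sigma> \<in> small k" if "\<sigma> \<in> small k" for k \<sigma>
  proof -
    from that obtain x where x: "x \<in> topspace X" "\<forall>v\<in>set (verts k \<sigma>). v \<in> topspace X \<and> A v \<subseteq> A x"
      by (auto simp: small_def)
    with t show ?thesis
      by (auto simp: small_def verts_simplex_map A_t continuous_map_def Pi_iff intro!: bexI[of _ "t x"] imageI) blast
  qed
  \<comment> \<open>Applying \<open>t\<close> raises all labels by 1 modulo \<open>p\<close>, so the
    evaluation changes only as the cochain does under this shift. The modulus \<open>q\<close> is
    kept free: for \<open>q = 0\<close> the congruence is an equality.\<close>
  have shift: "[simplex_eval A \<gamma> w k (simplex_map k t \<sigma>) = simplex_eval A \<gamma> v k \<sigma>] (mod q)"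
    if \<sigma>: "\<sigma> \<in> small k"
      and vw: "\<And>gs hs. length gs = Suc k \<Longrightarrow> list_all2 (\<lambda>a b. [b = a + 1] (mod ?q)) gs hs \<Longrightarrow> [w hs = v gs] (mod q)"
    for k \<sigma> v w q
  proof -
    from \<sigma> obtain x where x: "x \<in> topspace X" "\<And>v. v \<in> set (verts k \<sigma>) \<Longrightarrow> v \<in> topspace X \<and> A v \<subseteq> A x"
      by (auto simp: small_def)
    let ?Bs = "map A (verts k \<sigma>)"
    have map: "map A (verts k (simplex_map k t \<sigma>)) = map ((`) \<tau>) ?Bs"
      using x(2) by (simp add: verts_simplex_map A_t)
    have "[sd_eval \<gamma> (Suc k) v ?Bs = sd_eval (\<lambda>B. \<gamma> (\<tau> ` B)) (Suc k) w ?Bs] (mod q)"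
    proof (rule sd_eval_cong_mod)
      fix Cs assume Cs: "Cs \<noteq> []" "set Cs \<subseteq> set ?Bs"
      show "[\<gamma> (\<tau> ` \<Union> (set Cs)) = \<gamma> (\<Union> (set Cs)) + 1] (mod ?q)"
      proof (rule \<gamma>[OF x(1)])
        show "\<Union> (set Cs) \<subseteq> A x" using Cs x(2) by fastforce
        from Cs obtain v where "v \<in> set (verts k \<sigma>)" "A v \<in> set Cs"
          by (cases Cs) auto
        with A_fin x(2) show "\<Union> (set Cs) \<noteq> {}" by blast
      qed
    qed (auto intro: cong_sym[OF vw])
    then show ?thesis
      by (simp only: simplex_eval_def map sd_eval_map_image cong_sym)
  qed
  have E_t: "E (\<lambda>_. 1) k (chain_map k t e) = E (\<lambda>_. 1) k e" if "Poly_Mapping.keys e \<subseteq> small k" for k e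
    unfolding E_def frag_eval_chain_map
  proof (rule frag_eval_cong)
    fix \<sigma> assume "\<sigma> \<in> Poly_Mapping.keys e"
    with that have "\<sigma> \<in> small k" by blast
    from shift[OF this, of "cup_bock ?q (\<lambda>_. 1)" "cup_bock ?q (\<lambda>_. 1)" 0]
    show "simplex_eval A \<gamma> (cup_bock ?q (\<lambda>_. 1)) k (simplex_map k t \<sigma>) = simplex_eval A \<gamma> (cup_bock ?q (\<lambda>_. 1)) k \<sigma>"
      by (simp add: cup_bock_shift)
  qed
  have E_t_pow: "E (\<lambda>_. 1) k ((chain_map k t ^^ i) e) = E (\<lambda>_. 1) k e \<and>
      Poly_Mapping.keys ((chain_map k t ^^ i) e) \<subseteq> small k" if "Poly_Mapping.keys e \<subseteq> small k" for k e i
  proof (induction i)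
    case (Suc i)
    then show ?case
      using keys_chain_map[of k t "(chain_map k t ^^ i) e"] small_t by (auto simp: E_t)
  qed (use that in simp)
  have E_t_id: "[E (\<lambda>a. a) k (chain_map k t e - e) = E (\<lambda>_. 1) k e] (mod ?q)"
    if "Poly_Mapping.keys e \<subseteq> small k" "even k" for k e
  proof -
    \<comment> \<open>The sum of two cochains is written as a difference so that
      \<open>sd_eval_diff\<close> and \<open>sd_eval_mult\<close> apply.\<close>
    let ?v = "\<lambda>gs. cup_bock ?q (\<lambda>a. a) gs - (-1) * cup_bock ?q (\<lambda>_. 1) gs"
    have "[frag_eval (\<lambda>\<sigma>. simplex_eval A \<gamma> (cup_bock ?q (\<lambda>a. a)) k (simplex_map k t \<sigma>)) e
      = frag_eval (simplex_eval A \<gamma> ?v k) e] (mod ?q)"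
    proof (rule frag_eval_cong_mod, rule shift)
      fix gs hs assume "length gs = Suc k" "list_all2 (\<lambda>a b. [b = a + 1] (mod ?q)) gs hs"
      with cup_bock_id_shift[of ?q gs hs] \<open>even k\<close>
      show "[cup_bock ?q (\<lambda>a. a) hs = ?v gs] (mod ?q)"
        by (auto simp: cong_iff_dvd_diff algebra_simps)
    qed (use that in auto)
    also have "simplex_eval A \<gamma> ?v k = (\<lambda>\<sigma>. simplex_eval A \<gamma> (cup_bock ?q (\<lambda>a. a)) k \<sigma>
        - (-1) * simplex_eval A \<gamma> (cup_bock ?q (\<lambda>_. 1)) k \<sigma>)"
      unfolding simplex_eval_def by (simp only: sd_eval_diff sd_eval_mult)
    finally have "[E (\<lambda>a. a) k (chain_map k t e) = E (\<lambda>a. a) k e + E (\<lambda>_. 1) k e] (mod ?q)"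
      by (simp only: E_def frag_eval_chain_map frag_eval_fun_diff frag_eval_fun_mult) simp
    then show ?thesis
      by (simp add: E_def frag_eval_diff cong_iff_dvd_diff algebra_simps)
  qed
  have E_Suc: "[E (\<lambda>_. 1) (Suc k) (c (Suc k)) = E (\<lambda>_. 1) k (c k)] (mod ?q)" if "k < N" for k
  proof (cases "even k")
    \<comment> \<open>For even \<open>k\<close> the class in degree \<open>Suc k\<close> is, modulo
      \<open>p\<close>, the coboundary of the weighted cochain, whose value on the difference of a
      translate and the chain itself is that of the class in degree \<open>k\<close>.\<close>
    case True
    have "[E (\<lambda>_. 1) (Suc k) (c (Suc k)) = frag_eval (simplex_eval A \<gamma> (alt (cup_bock ?q (\<lambda>a. a))) (Suc k)) (c (Suc k))] (mod ?q)"
      unfolding E_def simplex_eval_def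
      using True \<open>1 < p\<close>
      by (intro frag_eval_cong_mod sd_eval_cong_mod[where R = "(=)"]) (auto simp: list.rel_eq alt_cup_bock_id cong_sym)
    also have "frag_eval (simplex_eval A \<gamma> (alt (cup_bock ?q (\<lambda>a. a))) (Suc k)) (c (Suc k))
        = E (\<lambda>a. a) k (periodic_boundary p t k (c k))"
      by (simp add: E_def c_Suc[OF that] flip: frag_eval_chain_boundary)
    also have "[\<dots> = E (\<lambda>_. 1) k (c k)] (mod ?q)"
      using True E_t_id[OF c_small[of k] True] that by (simp add: periodic_boundary_def)
    finally show ?thesis .
  next
    \<comment> \<open>For odd \<open>k\<close> the coboundary of the class is \<open>p\<close> times
      the next one, and by invariance the sum over the \<open>p\<close> translates also contributes
      a factor \<open>p\<close>. Both are equalities of integers, so \<open>p\<close>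
      cancels.\<close>
    case False
    have "?q * E (\<lambda>_. 1) (Suc k) (c (Suc k)) = frag_eval (simplex_eval A \<gamma> (alt (cup_bock ?q (\<lambda>_. 1))) (Suc k)) (c (Suc k))"
      unfolding E_def frag_eval_fun_mult[symmetric] simplex_eval_def sd_eval_mult[symmetric]
    proof (intro frag_eval_cong sd_eval_cong_mod[where R = "(=)" and q = 0, simplified])
      fix gs hs :: "int list" assume "length gs = Suc (Suc k)" "list_all2 (=) gs hs"
      then show "?q * cup_bock ?q (\<lambda>_. 1) gs = alt (cup_bock ?q (\<lambda>_. 1)) hs"
        using False \<open>1 < p\<close> by (simp add: list.rel_eq alt_cup_bock_odd)
    qed simp_all
    also have "\<dots> = E (\<lambda>_. 1) k (periodic_boundary p t k (c k))"
      by (simp add: E_def c_Suc[OF that] flip: frag_eval_chain_boundary)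
    also have "\<dots> = ?q * E (\<lambda>_. 1) k (c k)"
    proof -
      have "E (\<lambda>_. 1) k (\<Sum>i<p. (chain_map k t ^^ i) (c k)) = (\<Sum>i<p. E (\<lambda>_. 1) k (c k))"
        unfolding E_def frag_eval_sum
        using E_t_pow[OF c_small[of k]] that by (auto simp: E_def intro!: sum.cong)
      with False show ?thesis by (simp add: periodic_boundary_def)
    qed
    finally show ?thesis
      using \<open>1 < p\<close> by simp
  qed
  have "[E (\<lambda>_. 1) k (c k) = 1] (mod ?q)" if "k \<le> N" for k
    using that
  proof (induction k)
    case 0
    show ?case by (simp add: E_def c_0 simplex_eval_def verts_def)
  next
    case (Suc k)
    then show ?case
      using E_Suc[of k] by (auto intro: cong_trans)
  qed
  moreover have "E (\<lambda>_. 1) N (c N) = 0"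
  proof -
    have "E (\<lambda>_. 1) N (c N) = frag_eval (\<lambda>_. 0) (c N)"
      unfolding E_def simplex_eval_def
    proof (intro frag_eval_cong sd_eval_eq_0)
      fix \<sigma> assume "\<sigma> \<in> Poly_Mapping.keys (c N)"
      then obtain x where x: "x \<in> topspace X" "\<And>v. v \<in> set (verts N \<sigma>) \<Longrightarrow> v \<in> topspace X \<and> A v \<subseteq> A x"
        using c_small[of N] by (auto simp: small_def)
      then have sub: "\<Union> (set (map A (verts N \<sigma>))) \<subseteq> A x"
        by auto
      from sub show "finite (\<Union> (set (map A (verts N \<sigma>))))"
        using A_fin[OF x(1)] finite_subset by blast
      show "card (\<Union> (set (map A (verts N \<sigma>)))) < Suc N"
        using card_mono[OF _ sub] A_fin[OF x(1)] by simp
      show "B \<noteq> {}" if "B \<in> set (map A (verts N \<sigma>))" for B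
        using that x(2) A_fin by auto
    qed (simp_all add: cup_bock_not_distinct_adj)
    also have "\<dots> = 0"
      using frag_eval_fun_mult[of 0 "\<lambda>_. 0"] by simp
    finally show ?thesis .
  qed
  ultimately have "[0 = 1] (mod ?q)"
    by (metis order_refl)
  with \<open>1 < p\<close> show False
    by (simp add: cong_def)
qed

subsection \<open>Iterated joins\<close>

lemma simplex_map_comp_oriented_simplex:
  "simplex_map k (\<lambda>u. u \<circ> \<pi>) (oriented_simplex k l) = oriented_simplex k (\<lambda>j. l j \<circ> \<pi>)"
  by (auto simp: simplex_map_def oriented_simplex_def fun_eq_iff)

lemma chain_map_pow:
  fixes t :: "'a \<Rightarrow> 'a"
  assumes "singular_chain k X c"
  shows "(chain_map k t ^^ i) c = chain_map k (t ^^ i) c"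
proof (induction i)
  case 0
  show ?case
    using chain_map_ident[OF assms] by (simp add: id_def)
next
  case (Suc i)
  then show ?case
    using fun_cong[OF chain_map_compose[of k t "t ^^ i"], of c] by (simp add: comp_def)
qed

lemma chain_boundary_chain_map_pow:
  assumes "continuous_map X X t" "singular_chain k X c"
  shows "chain_boundary k ((chain_map k t ^^ i) c) = (chain_map (k - Suc 0) t ^^ i) (chain_boundary k c)"
  by (induction i)
     (simp_all add: chain_boundary_chain_map[of _ X] singular_chain_chain_map_pow[OF assms])

text \<open>The differentials alternate between t - 1 and the norm; their product telescopes to t^p
  - 1, which is zero.\<close>

lemma chain_boundary_periodic_boundary:
  assumes "continuous_map X X t" "singular_chain (Suc k) X c" "singular_chain k X e"
    and "chain_boundary (Suc k) c = periodic_boundary p t k e" "t ^^ p = id"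
  shows "chain_boundary (Suc k) (periodic_boundary p t (Suc k) c) = 0"
proof -
  let ?T = "chain_map k t"
  have tele: "(\<Sum>i<p. (?T ^^ Suc i) e) - (\<Sum>i<p. (?T ^^ i) e) = 0"
  proof -
    have "(?T ^^ p) e = e"
      using assms(3,5) by (simp add: chain_map_pow[of _ X] chain_map_ident[of _ X])
    then show ?thesis
      using sum_lessThan_telescope[of "\<lambda>i. (?T ^^ i) e" p] by (simp add: sum_subtractf)
  qed
  have pow: "(?T ^^ i) (a - b) = (?T ^^ i) a - (?T ^^ i) b" for i a b
    by (induction i) (simp_all add: chain_map_diff)
  show ?thesis
  proof (cases "even k")
    case True
    have "chain_boundary (Suc k) (periodic_boundary p t (Suc k) c) = (\<Sum>i<p. (?T ^^ i) (?T e - e))"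
      using True assms(4) chain_boundary_chain_map_pow[OF assms(1,2)]
      by (simp add: periodic_boundary_def chain_boundary_sum)
    also have "\<dots> = (\<Sum>i<p. (?T ^^ Suc i) e) - (\<Sum>i<p. (?T ^^ i) e)"
      by (simp add: pow sum_subtractf funpow_swap1)
    finally show ?thesis using tele by simp
  next
    case False
    have "chain_boundary (Suc k) (periodic_boundary p t (Suc k) c)
        = ?T (\<Sum>i<p. (?T ^^ i) e) - (\<Sum>i<p. (?T ^^ i) e)"
      using False assms(4) chain_boundary_chain_map[OF assms(2)]
      by (simp add: periodic_boundary_def chain_boundary_diff)
    also have "\<dots> = (\<Sum>i<p. (?T ^^ Suc i) e) - (\<Sum>i<p. (?T ^^ i) e)"
      by (simp add: chain_map_sum)
    finally show ?thesis using tele by simp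
  qed
qed

text \<open>Each chain is the cone over the periodic boundary of the previous one, with a new apex;
  once \<open>\<pi> ^^ p = id\<close>, that periodic boundary is its boundary. Geometrically, this
  is an iterated join of the orbits of the points \<open>v k\<close>.\<close>

primrec join_chain :: "nat \<Rightarrow> (nat \<Rightarrow> nat) \<Rightarrow> (nat \<Rightarrow> nat \<Rightarrow> real) \<Rightarrow> nat \<Rightarrow> (nat \<Rightarrow> real) chain" where
  "join_chain p \<pi> v 0 = frag_of (oriented_simplex 0 (\<lambda>_. v 0))"
| "join_chain p \<pi> v (Suc k) =
    simplicial_cone k (v (Suc k)) (periodic_boundary p (\<lambda>u. u \<circ> \<pi>) k (join_chain p \<pi> v k))"

text \<open>Vertex \<open>0\<close> of a simplex is the apex added last, hence the index \<open>k - j\<close>.\<close>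

definition join_simplices :: "(nat \<Rightarrow> nat) \<Rightarrow> (nat \<Rightarrow> nat \<Rightarrow> real) \<Rightarrow> nat \<Rightarrow> ((nat \<Rightarrow> real) \<Rightarrow> nat \<Rightarrow> real) set"
  where "join_simplices \<pi> v k =
    {oriented_simplex k l |l. \<forall>j\<le>k. \<exists>g. l j = v (k - j) \<circ> (\<pi> ^^ g)}"

lemma simplex_map_join_simplices:
  assumes "\<sigma> \<in> join_simplices \<pi> v k"
  shows "simplex_map k (\<lambda>u. u \<circ> \<pi>) \<sigma> \<in> join_simplices \<pi> v k"
proof -
  from assms obtain l g where l: "\<sigma> = oriented_simplex k l" "\<And>j. j \<le> k \<Longrightarrow> l j = v (k - j) \<circ> (\<pi> ^^ g j)"
    unfolding join_simplices_def by (auto simp: Ex_list_of_length) metis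
  then have "\<forall>j\<le>k. l j \<circ> \<pi> = v (k - j) \<circ> (\<pi> ^^ Suc (g j))"
    by (simp add: o_assoc funpow_Suc_right del: funpow.simps)
  then show ?thesis
    unfolding l(1) simplex_map_comp_oriented_simplex join_simplices_def by blast
qed

lemma keys_periodic_boundary:
  assumes "Poly_Mapping.keys c \<subseteq> S" "\<And>\<sigma>. \<sigma> \<in> S \<Longrightarrow> simplex_map k t \<sigma> \<in> S"
  shows "Poly_Mapping.keys (periodic_boundary p t k c) \<subseteq> S"
proof -
  have *: "Poly_Mapping.keys (chain_map k t c) \<subseteq> S" if "Poly_Mapping.keys c \<subseteq> S" for c
    using keys_chain_map[of k t c] that assms(2) by blast
  have "Poly_Mapping.keys ((chain_map k t ^^ i) c) \<subseteq> S" for i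
    by (induction i) (simp_all add: assms(1) *)
  then show ?thesis
    using *[OF assms(1)] assms(1) keys_diff[of "chain_map k t c" c]
      keys_sum[of "\<lambda>i. (chain_map k t ^^ i) c" "{..<p}"]
    by (cases "even k") (auto simp: periodic_boundary_def dest!: subsetD)
qed

lemma keys_join_chain: "Poly_Mapping.keys (join_chain p \<pi> v k) \<subseteq> join_simplices \<pi> v k"
proof (induction k)
  case 0
  have "oriented_simplex 0 (\<lambda>_. v 0) \<in> join_simplices \<pi> v 0"
    unfolding join_simplices_def by (auto intro!: exI[of _ "\<lambda>_. v 0"] exI[of _ 0])
  then show ?case by simp
next
  case (Suc k)
  let ?c = "periodic_boundary p (\<lambda>u. u \<circ> \<pi>) k (join_chain p \<pi> v k)"
  have c: "Poly_Mapping.keys ?c \<subseteq> join_simplices \<pi> v k"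
    using Suc by (intro keys_periodic_boundary simplex_map_join_simplices)
  have "simplex_cone k (v (Suc k)) \<sigma> \<in> join_simplices \<pi> v (Suc k)" if \<sigma>: "\<sigma> \<in> join_simplices \<pi> v k" for \<sigma>
  proof -
    from \<sigma> obtain l where l: "\<sigma> = oriented_simplex k l" "\<forall>j\<le>k. \<exists>g. l j = v (k - j) \<circ> (\<pi> ^^ g)"
      by (auto simp: join_simplices_def)
    have "\<exists>g. (if j = 0 then v (Suc k) else l (j - 1)) = v (Suc k - j) \<circ> (\<pi> ^^ g)" if "j \<le> Suc k" for j
      using l(2) that by (cases j) (auto intro: exI[of _ 0])
    then show ?thesis
      unfolding l(1) simplex_cone join_simplices_def by blast
  qed
  then show ?case
    using c keys_frag_extend[of "frag_of \<circ> simplex_cone k (v (Suc k))" ?c]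
    by (fastforce simp: simplicial_cone_def)
qed

lemma simplicial_chain_join_chain: "simplicial_chain k UNIV (join_chain p \<pi> v k)"
  using keys_join_chain[of p \<pi> v k]
  by (fastforce simp: simplicial_chain_def join_simplices_def simplicial_simplex)

lemma singular_chain_join_chain: "singular_chain k (powertop_real UNIV) (join_chain p \<pi> v k)"
  using simplicial_imp_singular_chain[OF simplicial_chain_join_chain] by simp

text \<open>The boundary of a cone over a cycle is that cycle. In degree 0 the correction term at
  the apex vanishes because the periodic boundary is a difference of two points.\<close>

lemma chain_boundary_join_chain:
  assumes "\<pi> ^^ p = id"
  shows "chain_boundary (Suc k) (join_chain p \<pi> v (Suc k))
    = periodic_boundary p (\<lambda>u. u \<circ> \<pi>) k (join_chain p \<pi> v k)"
proof (induction k)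
  case 0
  let ?c = "periodic_boundary p (\<lambda>u. u \<circ> \<pi>) 0 (join_chain p \<pi> v 0)"
  have "simplicial_chain 0 UNIV ?c"
    by (auto simp: periodic_boundary_def simplex_map_comp_oriented_simplex simplicial_simplex
        intro!: simplicial_chain_diff)
  from chain_boundary_simplicial_cone[OF this, of "v (Suc 0)"] show ?case
    by (simp add: periodic_boundary_def frag_extend_diff comp_def)
next
  case (Suc k)
  let ?t = "\<lambda>u::nat \<Rightarrow> real. u \<circ> \<pi>"
  let ?c = "periodic_boundary p ?t (Suc k) (join_chain p \<pi> v (Suc k))"
  have t: "continuous_map (powertop_real UNIV) (powertop_real UNIV) ?t"
    by (auto simp: continuous_map_componentwise intro: continuous_map_product_projection)
  have "(?t ^^ i) = (\<lambda>u. u \<circ> (\<pi> ^^ i))" for i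
    by (induction i) (auto simp: fun_eq_iff funpow_swap1)
  with assms have "?t ^^ p = id"
    by auto
  then have "chain_boundary (Suc k) ?c = 0"
    by (intro chain_boundary_periodic_boundary[OF t _ _ Suc] singular_chain_join_chain)
  moreover have "simplicial_chain (Suc k) UNIV ?c"
  proof -
    have "Poly_Mapping.keys ?c \<subseteq> join_simplices \<pi> v (Suc k)"
      by (intro keys_periodic_boundary keys_join_chain simplex_map_join_simplices)
    then show ?thesis
      by (fastforce simp: simplicial_chain_def join_simplices_def simplicial_simplex)
  qed
  ultimately show ?case
    using chain_boundary_simplicial_cone[of "Suc k" UNIV ?c "v (Suc (Suc k))"]
    by (simp add: simplicial_cone_def comp_def)
qed

subsection \<open>Partitions and clustering\<close>

text \<open>The average of \<open>B\<close> in the integers modulo \<open>p\<close>;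
  \<open>SOME\<close> picks an inverse of \<open>card B\<close>, which exists if \<open>B\<close> is
  a nonempty proper subset of \<open>{..<p}\<close> and \<open>p\<close> is prime.\<close>

definition cyclic_mean :: "nat \<Rightarrow> nat set \<Rightarrow> int" where
  "cyclic_mean p B = (SOME c. [int (card B) * c = 1] (mod int p)) * (\<Sum>i\<in>B. int i)"

text \<open>The sum grows by \<open>card B * s\<close>, of which the inverse of
  \<open>card B\<close> leaves \<open>s\<close>. The image has the same cardinality, so the same
  inverse is picked on both sides.\<close>

lemma cyclic_mean_shift:
  assumes "prime p" "B \<subset> {..<p}" "B \<noteq> {}" "inj_on \<pi> B"
    and \<pi>: "\<And>i. i \<in> B \<Longrightarrow> [int (\<pi> i) = int i + s] (mod int p)"
  shows "[cyclic_mean p (\<pi> ` B) = cyclic_mean p B + s] (mod int p)"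
proof -
  have fin: "finite B"
    using assms(2) by (auto intro: finite_subset)
  have "0 < card B" "card B < p"
    using assms(2,3) fin psubset_card_mono[OF _ assms(2)] by (auto simp: card_gt_0_iff)
  then have "coprime (int (card B)) (int p)"
    using prime_imp_coprime[OF assms(1), of "card B"] nat_dvd_not_less[of "card B" p]
    by (simp add: coprime_commute)
  then have "\<exists>c. [int (card B) * c = 1] (mod int p)"
    by (rule cong_solve_coprime_int)
  then have c1: "[int (card B) * (SOME c. [int (card B) * c = 1] (mod int p)) = 1] (mod int p)"
    by (rule someI_ex)
  define c where "c = (SOME c. [int (card B) * c = 1] (mod int p))"
  have "[(\<Sum>i\<in>B. int (\<pi> i)) = (\<Sum>i\<in>B. int i + s)] (mod int p)"
    using \<pi> by (intro cong_sum) auto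
  from cong_scalar_left[OF this, of c]
  have "[c * (\<Sum>i\<in>B. int (\<pi> i)) = c * (\<Sum>i\<in>B. int i) + (int (card B) * c) * s] (mod int p)"
    by (simp add: sum.distrib algebra_simps)
  also have "[c * (\<Sum>i\<in>B. int i) + (int (card B) * c) * s = c * (\<Sum>i\<in>B. int i) + 1 * s] (mod int p)"
    using c1 unfolding c_def by (intro cong_add cong_refl cong_scalar_right)
  finally show ?thesis
    using assms(4) by (simp add: cyclic_mean_def card_image sum.reindex flip: c_def)
qed

section \<open>Nontrivial partitions of the labels\<close>

definition proper_equivs :: "nat \<Rightarrow> (nat \<times> nat) set set" where
  "proper_equivs p = {E. equiv {..<p} E \<and> E \<noteq> {..<p} \<times> {..<p} \<and> E \<noteq> Id_on {..<p}}"

lemma proper_equivs_subset: "E \<in> proper_equivs p \<Longrightarrow> E \<subseteq> {..<p} \<times> {..<p}"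
  unfolding proper_equivs_def by (auto dest: equiv_type)

lemma finite_proper_equivs [simp]: "finite (proper_equivs p)"
  by (rule finite_subset[of _ "Pow ({..<p} \<times> {..<p})"]) (auto dest: proper_equivs_subset)

text \<open>A subset attached to a partition without choices, hence compatible with permutations;
  its \<open>cyclic_mean\<close> will be the label of the partition.\<close>

definition large_classes :: "nat \<Rightarrow> (nat \<times> nat) set \<Rightarrow> nat set" where
  "large_classes p E = {i\<in>{..<p}. \<forall>j<p. card (E `` {j}) \<le> card (E `` {i})}"

text \<open>If all classes had the largest size, that size would divide the prime \<open>p\<close>,
  so it would be 1 or \<open>p\<close> and the partition trivial.\<close>

lemma large_classes_proper:
  assumes "prime p" "E \<in> proper_equivs p"
  shows "large_classes p E \<noteq> {}" "large_classes p E \<subset> {..<p}"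
proof -
  have "0 < p" using assms(1) by (rule prime_gt_0_nat)
  have E: "equiv {..<p} E" "E \<noteq> {..<p} \<times> {..<p}" "E \<noteq> Id_on {..<p}"
    using assms(2) by (auto simp: proper_equivs_def)
  let ?f = "\<lambda>i. card (E `` {i})"
  have "Max (?f ` {..<p}) \<in> ?f ` {..<p}"
    using \<open>0 < p\<close> by (intro Max_in) auto
  then obtain i where "i < p" "?f i = Max (?f ` {..<p})" by auto
  then have "i \<in> large_classes p E"
    by (auto simp: large_classes_def)
  then show "large_classes p E \<noteq> {}" by blast
  have "large_classes p E \<noteq> {..<p}"
  proof
    assume all: "large_classes p E = {..<p}"
    have same: "?f i = ?f 0" if "i < p" for i
    proof -
      have "i \<in> large_classes p E" "0 \<in> large_classes p E"
        using all that by auto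
      then show ?thesis
        using that by (simp add: large_classes_def le_antisym)
    qed
    have "?f 0 dvd card {..<p}"
    proof (rule equiv_imp_dvd_card[OF _ E(1)])
      fix X assume "X \<in> {..<p} // E"
      then obtain i where "i < p" "X = E `` {i}"
        by (auto simp: quotient_def)
      with same[of i] show "?f 0 dvd card X"
        by simp
    qed simp
    then have "?f 0 = 1 \<or> ?f 0 = p"
      using assms(1) by (simp add: prime_nat_iff)
    then consider "?f 0 = 1" | "?f 0 = p"
      by blast
    then show False
    proof cases
      case 1
      have "j = i" if "(i, j) \<in> E" for i j
      proof -
        have i: "i < p" using that equiv_type[OF E(1)] by auto
        have "card (E `` {i}) = 1"
          using same[OF i] 1 by simp
        then obtain a where a: "E `` {i} = {a}"
          by (rule card_1_singletonE)
        have "i \<in> E `` {i}" using equiv_class_self[OF E(1)] i by simp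
        with that a show ?thesis by auto
      qed
      then have "E \<subseteq> Id_on {..<p}"
        using equiv_type[OF E(1)] by auto
      moreover have "Id_on {..<p} \<subseteq> E"
        using E(1) by (auto simp: equiv_def refl_on_def)
      ultimately have "E = Id_on {..<p}"
        by (rule equalityI)
      with E(3) show False by simp
    next
      case 2
      have "E `` {i} = {..<p}" if "i < p" for i
        using 2 same[OF that] equiv_type[OF E(1)] by (intro card_subset_eq) auto
      then have "E = {..<p} \<times> {..<p}"
        using equiv_type[OF E(1)] by auto
      with E(2) show False by simp
    qed
  qed
  then show "large_classes p E \<subset> {..<p}"
    by (auto simp: large_classes_def)
qed

lemma equiv_rel_trans: "equiv S E \<Longrightarrow> (a, b) \<in> E \<Longrightarrow> (b, c) \<in> E \<Longrightarrow> (a, c) \<in> E"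
  by (rule transD[of E a b c]) (simp_all add: equiv_def)

lemma equiv_rel_sym: "equiv S E \<Longrightarrow> (a, b) \<in> E \<Longrightarrow> (b, a) \<in> E"
  by (rule symD[of E a b]) (simp_all add: equiv_def)

text \<open>The least elements of the classes: the number of classes becomes the cardinality of a
  set that shrinks as the partition gets coarser.\<close>

definition class_reps :: "nat \<Rightarrow> (nat \<times> nat) set \<Rightarrow> nat set" where
  "class_reps p E = {i\<in>{..<p}. \<forall>j<i. (j, i) \<notin> E}"

lemma class_rep_exists:
  assumes "equiv {..<p} E" "i < p"
  obtains a where "a \<in> class_reps p E" "(a, i) \<in> E"
proof -
  have "(i, i) \<in> E"
    using equiv_class_self[OF assms(1), of i] assms(2) by simp
  then have "\<exists>a. (a, i) \<in> E \<and> (\<forall>j<a. (j, i) \<notin> E)"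
    using exists_least_iff[of "\<lambda>a. (a, i) \<in> E"] by blast
  then obtain a where a: "(a, i) \<in> E" "\<And>j. j < a \<Longrightarrow> (j, i) \<notin> E"
    by blast
  have "(j, a) \<notin> E" if "j < a" for j
    using a(2)[OF that] equiv_rel_trans[OF assms(1) _ a(1), of j] by blast
  moreover have "a < p"
    using subsetD[OF equiv_type[OF assms(1)] a(1)] by simp
  ultimately have "a \<in> class_reps p E"
    by (simp add: class_reps_def)
  from that[OF this a(1)] show thesis .
qed

lemma class_reps_unique:
  assumes "equiv {..<p} E" "a \<in> class_reps p E" "b \<in> class_reps p E" "(a, b) \<in> E"
  shows "a = b"
proof (rule ccontr)
  assume "a \<noteq> b"
  then consider "a < b" | "b < a"
    by linarith
  then show False
    using equiv_rel_sym[OF assms(1,4)] assms(2-4) by cases (simp_all add: class_reps_def)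
qed

text \<open>For two labels related by \<open>E'\<close>, their representatives under
  \<open>E\<close> are also representatives under \<open>E'\<close> and related there, hence
  equal.\<close>

lemma class_reps_inj:
  assumes E: "equiv {..<p} E" and E': "equiv {..<p} E'"
    and sub: "E \<subseteq> E'" and eq: "class_reps p E = class_reps p E'"
  shows "E = E'"
proof (rule equalityI[OF sub], rule subrelI)
  fix i j assume ij: "(i, j) \<in> E'"
  have "i < p" "j < p"
    using subsetD[OF equiv_type[OF E'] ij] by simp_all
  obtain a where a: "a \<in> class_reps p E" "(a, i) \<in> E"
    using E \<open>i < p\<close> by (rule class_rep_exists)
  obtain b where b: "b \<in> class_reps p E" "(b, j) \<in> E"
    using E \<open>j < p\<close> by (rule class_rep_exists)
  have ab: "(a, b) \<in> E'"
    by (rule equiv_rel_trans[OF E' equiv_rel_trans[OF E' subsetD[OF sub a(2)] ij]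
        equiv_rel_sym[OF E' subsetD[OF sub b(2)]]])
  have "a = b"
    by (rule class_reps_unique[OF E' _ _ ab]) (use a(1) b(1) eq in simp_all)
  with b(2) show "(i, j) \<in> E"
    using equiv_rel_trans[OF E equiv_rel_sym[OF E a(2)]] by simp
qed

text \<open>The number of classes is neither 1 nor \<open>p\<close>. The \<open>p - 2\<close>
  remaining values bound the length of chains of nontrivial partitions.\<close>

lemma card_class_reps:
  assumes "0 < p" "E \<in> proper_equivs p"
  shows "card (class_reps p E) \<in> {2..<p}"
proof -
  have E: "equiv {..<p} E" "E \<noteq> {..<p} \<times> {..<p}" "E \<noteq> Id_on {..<p}"
    using assms(2) by (auto simp: proper_equivs_def)
  have sub: "class_reps p E \<subseteq> {..<p}"
    by (auto simp: class_reps_def)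
  have "class_reps p E \<noteq> {..<p}"
  proof
    assume "class_reps p E = {..<p}"
    then have "i = j" if "(i, j) \<in> E" for i j
    proof -
      have "i < p" "j < p"
        using that equiv_type[OF E(1)] by auto
      with \<open>class_reps p E = {..<p}\<close> show ?thesis
        by (intro class_reps_unique[OF E(1) _ _ that]) simp_all
    qed
    then have "E \<subseteq> Id_on {..<p}"
      using equiv_type[OF E(1)] by auto
    moreover have "Id_on {..<p} \<subseteq> E"
      using E(1) by (auto simp: equiv_def refl_on_def)
    ultimately have "E = Id_on {..<p}"
      by (rule equalityI)
    with E(3) show False by simp
  qed
  then have lt: "card (class_reps p E) < p"
    using psubset_card_mono[of "{..<p}" "class_reps p E"] sub by auto
  have "\<exists>i<p. (0, i) \<notin> E"
  proof (rule ccontr)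
    assume "\<not> ?thesis"
    then have zero: "(0, i) \<in> E" if "i < p" for i
      using that by blast
    have "(i, j) \<in> E" if "i < p" "j < p" for i j
      by (rule equiv_rel_trans[OF E(1) equiv_rel_sym[OF E(1) zero[OF that(1)]] zero[OF that(2)]])
    then have "{..<p} \<times> {..<p} \<subseteq> E"
      by auto
    with E(2) equiv_type[OF E(1)] show False by auto
  qed
  then obtain i where "i < p" "(0, i) \<notin> E" by blast
  obtain a where a: "a \<in> class_reps p E" "(a, i) \<in> E"
    using E(1) \<open>i < p\<close> by (rule class_rep_exists)
  have "a \<noteq> 0"
    using a(2) \<open>(0, i) \<notin> E\<close> by (intro notI) simp
  have "{0, a} \<subseteq> class_reps p E"
    using a(1) \<open>0 < p\<close> by (auto simp: class_reps_def)
  moreover have "finite (class_reps p E)"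
    using sub finite_subset by blast
  ultimately have "card {0, a} \<le> card (class_reps p E)"
    by (intro card_mono)
  with lt \<open>a \<noteq> 0\<close> show ?thesis by simp
qed

text \<open>The length of the interval of scales at which single-linkage clustering yields the partition
  \<open>E\<close> would be the natural weight; this product has the same support and is visibly continuous.\<close>

definition cluster_weight :: "nat \<Rightarrow> (nat \<times> nat \<Rightarrow> real) \<Rightarrow> (nat \<times> nat) set \<Rightarrow> real" where
  "cluster_weight p D E = (\<Prod>a\<in>E. \<Prod>b\<in>{..<p} \<times> {..<p} - E. max 0 (D b - D a))"

definition cluster_point :: "nat \<Rightarrow> (nat \<times> nat) set \<Rightarrow> nat" where
  "cluster_point p E = nat (cyclic_mean p (large_classes p E) mod int p)"

definition cluster_height :: "nat \<Rightarrow> (nat \<times> nat \<Rightarrow> real) \<Rightarrow> nat \<Rightarrow> real" where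
  "cluster_height p D i = (\<Sum>E | E \<in> proper_equivs p \<and> cluster_point p E = i. cluster_weight p D E)"

lemma cluster_weight_nonneg: "0 \<le> cluster_weight p D E"
  by (auto simp: cluster_weight_def intro!: prod_nonneg)

lemma cluster_weight_pos_iff:
  assumes "E \<in> proper_equivs p"
  shows "0 < cluster_weight p D E \<longleftrightarrow> (\<forall>a\<in>E. \<forall>b\<in>{..<p} \<times> {..<p} - E. D a < D b)"
proof -
  have "finite E"
    using proper_equivs_subset[OF assms] by (rule finite_subset) simp
  moreover have "max 0 (D b - D a) = 0 \<longleftrightarrow> \<not> D a < D b" for a b
    by linarith
  ultimately have "cluster_weight p D E = 0 \<longleftrightarrow> \<not> (\<forall>a\<in>E. \<forall>b\<in>{..<p} \<times> {..<p} - E. D a < D b)"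
    by (simp add: cluster_weight_def)
  with cluster_weight_nonneg[of p D E] show ?thesis
    by linarith
qed

text \<open>Partitions of positive weight consist of the pairs where \<open>D\<close> is smallest,
  hence are nested. Along such a chain the number of classes is injective, and it takes at most
  \<open>p - 2\<close> values.\<close>

lemma card_cluster_height_support:
  assumes "0 < p"
  shows "card {i. cluster_height p D i \<noteq> 0} \<le> p - 2" "finite {i. cluster_height p D i \<noteq> 0}"
proof -
  let ?S = "{E \<in> proper_equivs p. cluster_weight p D E > 0}"
  have sub: "{i. cluster_height p D i \<noteq> 0} \<subseteq> cluster_point p ` ?S"
  proof
    fix i assume "i \<in> {i. cluster_height p D i \<noteq> 0}"
    then have "(\<Sum>E | E \<in> proper_equivs p \<and> cluster_point p E = i. cluster_weight p D E) \<noteq> 0"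
      by (simp add: cluster_height_def)
    then obtain E where E: "E \<in> proper_equivs p" "cluster_point p E = i" "cluster_weight p D E \<noteq> 0"
      by (rule sum.not_neutral_contains_not_neutral) blast
    have "0 < cluster_weight p D E"
      using cluster_weight_nonneg[of p D E] E(3) by simp
    with E(1,2) show "i \<in> cluster_point p ` ?S"
      by blast
  qed
  have fin: "finite ?S" by simp
  show "finite {i. cluster_height p D i \<noteq> 0}"
    using sub by (rule finite_subset) simp
  have "card {i. cluster_height p D i \<noteq> 0} \<le> card (cluster_point p ` ?S)"
    using sub by (rule card_mono[rotated]) simp
  then have le: "card {i. cluster_height p D i \<noteq> 0} \<le> card ?S"
    using card_image_le[OF fin] by (rule order_trans)
  have "inj_on (\<lambda>E. card (class_reps p E)) ?S"
  proof (rule inj_onI)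
    fix E E' assume E: "E \<in> ?S" "E' \<in> ?S" and eq: "card (class_reps p E) = card (class_reps p E')"
    have *: "F = F'" if F: "F \<in> ?S" "F' \<in> ?S" "F \<subseteq> F'" "card (class_reps p F) = card (class_reps p F')" for F F'
    proof (rule class_reps_inj)
      show "class_reps p F = class_reps p F'"
      proof (rule card_subset_eq[symmetric])
        show "class_reps p F' \<subseteq> class_reps p F"
          using F(3) by (auto simp: class_reps_def)
      qed (use F in \<open>auto simp: class_reps_def\<close>)
    qed (use F in \<open>auto simp: proper_equivs_def\<close>)
    have "E \<subseteq> E' \<or> E' \<subseteq> E"
    proof (rule ccontr)
      assume "\<not> ?thesis"
      then obtain a b where a: "a \<in> E" "a \<notin> E'" and b: "b \<in> E'" "b \<notin> E" by blast
      have "a \<in> {..<p} \<times> {..<p}" "b \<in> {..<p} \<times> {..<p}"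
        using subsetD[OF proper_equivs_subset, of E p a] subsetD[OF proper_equivs_subset, of E' p b]
          E a(1) b(1) by simp_all
      moreover have "\<forall>a\<in>E. \<forall>b\<in>{..<p} \<times> {..<p} - E. D a < D b" "\<forall>a\<in>E'. \<forall>b\<in>{..<p} \<times> {..<p} - E'. D a < D b"
        using E cluster_weight_pos_iff[of E p D] cluster_weight_pos_iff[of E' p D] by simp_all
      ultimately have "D a < D b" "D b < D a"
        using a b by blast+
      then show False by simp
    qed
    then show "E = E'"
      using *[OF E _ eq] *[OF E(2,1) _ eq[symmetric]] by blast
  qed
  then have "card ?S = card ((\<lambda>E. card (class_reps p E)) ` ?S)"
    by (rule card_image[symmetric])
  also have "\<dots> \<le> card {2..<p}"
    using card_class_reps[OF assms] by (intro card_mono) auto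
  finally show "card {i. cluster_height p D i \<noteq> 0} \<le> p - 2"
    using le by simp
qed

text \<open>The partition given by distance 0 has positive weight, and no other weight is
  negative.\<close>

lemma cluster_height_pos:
  assumes D: "\<And>a. 0 \<le> D a" and E: "{a \<in> {..<p} \<times> {..<p}. D a = 0} \<in> proper_equivs p" and "0 < p"
  shows "\<exists>i<p. 0 < cluster_height p D i"
proof -
  let ?E = "{a \<in> {..<p} \<times> {..<p}. D a = 0}"
  have "0 < cluster_weight p D ?E"
    by (rule iffD2[OF cluster_weight_pos_iff[OF E]]) (use D in \<open>auto simp: less_le\<close>)
  also have "\<dots> \<le> cluster_height p D (cluster_point p ?E)"
    unfolding cluster_height_def using E cluster_weight_nonneg by (intro member_le_sum) auto
  finally show ?thesis
    using \<open>0 < p\<close> by (intro exI[of _ "cluster_point p ?E"]) (simp add: cluster_point_def nat_less_iff)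
qed

lemma continuous_on_cluster_height:
  assumes "\<And>a. continuous_on S (\<lambda>u. D u a)"
  shows "continuous_on S (\<lambda>u. cluster_height p (D u) i)"
  unfolding cluster_height_def cluster_weight_def
  by (intro continuous_intros assms)

section \<open>Equivariance of clustering under rotation\<close>

definition rotate_lt :: "nat \<Rightarrow> nat \<Rightarrow> nat" where
  "rotate_lt p i = (if i < p then Suc i mod p else i)"

lemma rotate_lt_permutes: "rotate_lt p permutes {..<p}"
proof (rule bij_imp_permutes)
  have "inj_on (rotate_lt p) {..<p}"
    by (auto simp: inj_on_def rotate_lt_def mod_Suc split: if_splits)
  moreover have "rotate_lt p ` {..<p} \<subseteq> {..<p}"
    by (auto simp: rotate_lt_def)
  ultimately show "bij_betw (rotate_lt p) {..<p} {..<p}"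
    by (simp add: bij_betw_def endo_inj_surj)
qed (simp add: rotate_lt_def)

lemma cong_rotate_lt: "i < p \<Longrightarrow> [int (rotate_lt p i) = int i + 1] (mod int p)"
  by (simp add: rotate_lt_def cong_def zmod_int add.commute)

lemma map_prod_image_conv_inv_image:
  fixes \<pi> :: "'a \<Rightarrow> 'a"
  assumes "bij \<pi>"
  shows "map_prod \<pi> \<pi> ` E = inv_image E (inv_into UNIV \<pi>)"
proof -
  have inv: "inv_into UNIV \<pi> (\<pi> a) = a" "\<pi> (inv_into UNIV \<pi> a) = a" for a
    using assms by (simp_all add: bij_is_inj bij_is_surj surj_f_inv_f)
  have "z \<in> map_prod \<pi> \<pi> ` E" if "z \<in> inv_image E (inv_into UNIV \<pi>)" for z
  proof
    show "map_prod (inv_into UNIV \<pi>) (inv_into UNIV \<pi>) z \<in> E"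
      using that by (cases z) simp
    show "z = map_prod \<pi> \<pi> (map_prod (inv_into UNIV \<pi>) (inv_into UNIV \<pi>) z)"
      by (cases z) (simp add: inv)
  qed
  then show ?thesis
    by (auto simp: inv)
qed

lemma proper_equivs_inv_image:
  assumes \<sigma>: "\<sigma> permutes {..<p}" and "E \<in> proper_equivs p"
  shows "inv_image E \<sigma> \<in> proper_equivs p"
proof -
  have E: "equiv {..<p} E" "E \<noteq> {..<p} \<times> {..<p}" "E \<noteq> Id_on {..<p}"
    using assms(2) by (auto simp: proper_equivs_def)
  have lt: "\<sigma> i < p \<longleftrightarrow> i < p" for i
    using permutes_in_image[OF \<sigma>, of i] by simp
  have inv: "inv_image (inv_image E \<sigma>) (inv_into UNIV \<sigma>) = E"
    using permutes_inverses[OF \<sigma>] by (auto simp: inv_image_def)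
  have "equiv {..<p} (inv_image E \<sigma>)"
    using E(1) lt by (auto simp: equiv_def refl_on_def in_inv_image sym_def intro: trans_inv_image)
  moreover have "inv_image E \<sigma> \<noteq> {..<p} \<times> {..<p}"
  proof
    assume "inv_image E \<sigma> = {..<p} \<times> {..<p}"
    then have "E = inv_image ({..<p} \<times> {..<p}) (inv_into UNIV \<sigma>)"
      using inv by simp
    also have "\<dots> = {..<p} \<times> {..<p}"
      using permutes_in_image[OF permutes_inv[OF \<sigma>]] by (auto simp: inv_image_def)
    finally show False using E(2) by simp
  qed
  moreover have "inv_image E \<sigma> \<noteq> Id_on {..<p}"
  proof
    assume "inv_image E \<sigma> = Id_on {..<p}"
    then have "E = inv_image (Id_on {..<p}) (inv_into UNIV \<sigma>)"
      using inv by simp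
    also have "\<dots> = Id_on {..<p}"
      using permutes_in_image[OF permutes_inv[OF \<sigma>]] permutes_inj[OF permutes_inv[OF \<sigma>]]
      by (auto simp: inv_image_def Id_on_def inj_def)
    finally show False using E(3) by simp
  qed
  ultimately show ?thesis
    by (simp add: proper_equivs_def)
qed

lemma large_classes_inv_image:
  assumes \<sigma>: "\<sigma> permutes {..<p}"
  shows "large_classes p (inv_image E \<sigma>) = inv_into UNIV \<sigma> ` large_classes p E"
proof -
  have card: "card (inv_image E \<sigma> `` {i}) = card (E `` {\<sigma> i})" for i
  proof -
    have "y \<in> inv_into UNIV \<sigma> ` (E `` {\<sigma> i})" if "y \<in> inv_image E \<sigma> `` {i}" for y
      using that permutes_inverses(2)[OF \<sigma>, of y] by (intro image_eqI[of _ _ "\<sigma> y"]) auto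
    then have "inv_image E \<sigma> `` {i} = inv_into UNIV \<sigma> ` (E `` {\<sigma> i})"
      using permutes_inverses(1)[OF \<sigma>] by auto
    then show ?thesis
      using permutes_inj[OF permutes_inv[OF \<sigma>]] by (simp add: card_image inj_on_subset[OF _ subset_UNIV])
  qed
  have lt: "\<sigma> i < p \<longleftrightarrow> i < p" for i
    using permutes_in_image[OF \<sigma>, of i] by simp
  have all: "(\<forall>j<p. P (\<sigma> j)) \<longleftrightarrow> (\<forall>j<p. P j)" for P
    using lt permutes_inverses(1)[OF \<sigma>] by metis
  have "i \<in> large_classes p (inv_image E \<sigma>) \<longleftrightarrow> \<sigma> i \<in> large_classes p E" for i
    using all[of "\<lambda>j. card (E `` {j}) \<le> card (E `` {\<sigma> i})"] by (simp add: large_classes_def card lt)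
  then have "large_classes p (inv_image E \<sigma>) = \<sigma> -` large_classes p E"
    by auto
  then show ?thesis
    using bij_vimage_eq_inv_image[OF permutes_bij[OF \<sigma>]] by simp
qed

text \<open>The inverse image under the inverse rotation is the rotated partition. Its largest
  classes are rotated along, which raises their cyclic mean by 1.\<close>

lemma cluster_point_rotate:
  assumes "prime p" "E \<in> proper_equivs p"
  shows "cluster_point p (inv_image E (inv_into UNIV (rotate_lt p))) = rotate_lt p (cluster_point p E)"
proof -
  let ?r = "rotate_lt p"
  have r: "inv_into UNIV (inv_into UNIV ?r) = ?r"
    using rotate_lt_permutes by (rule permutes_inv_inv)
  have "0 < p" using assms(1) by (rule prime_gt_0_nat)
  let ?m = "cyclic_mean p (large_classes p E)"
  have "[cyclic_mean p (?r ` large_classes p E) = ?m + 1] (mod int p)"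
    using large_classes_proper[OF assms] permutes_inj[OF rotate_lt_permutes]
    by (intro cyclic_mean_shift assms(1) cong_rotate_lt) (auto intro: inj_on_subset)
  then have eq: "cyclic_mean p (?r ` large_classes p E) mod int p = (?m mod int p + 1) mod int p"
    unfolding cong_def by (simp only: mod_add_left_eq)
  have "?m mod int p = int (cluster_point p E)"
    using \<open>0 < p\<close> by (simp add: cluster_point_def)
  moreover have "cluster_point p E < p"
    using \<open>0 < p\<close> by (simp add: cluster_point_def nat_less_iff)
  ultimately have "cyclic_mean p (?r ` large_classes p E) mod int p = int (?r (cluster_point p E))"
    using eq by (simp add: rotate_lt_def zmod_int add.commute)
  then show ?thesis
    unfolding cluster_point_def[of p "inv_image E (inv_into UNIV ?r)"]
      large_classes_inv_image[OF permutes_inv[OF rotate_lt_permutes]] r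
    by simp
qed

lemma cluster_weight_map_prod:
  assumes \<pi>: "\<pi> permutes {..<p}"
  shows "cluster_weight p (D \<circ> map_prod \<pi> \<pi>) E = cluster_weight p D (map_prod \<pi> \<pi> ` E)"
proof -
  let ?R = "map_prod \<pi> \<pi>" and ?P = "{..<p} \<times> {..<p}"
  have inj: "inj ?R"
    using permutes_inj[OF \<pi>] by (intro prod.inj_map)
  have "?R ` ?P = ?P"
    using permutes_image[OF \<pi>] by (simp add: map_prod_surj_on)
  then have "?P - ?R ` E = ?R ` (?P - E)"
    using inj by (simp add: image_set_diff)
  then show ?thesis
    using inj by (simp add: cluster_weight_def prod.reindex inj_on_subset[OF _ subset_UNIV])
qed

lemma cluster_height_rotate:
  assumes "prime p"
  shows "cluster_height p (D \<circ> map_prod (rotate_lt p) (rotate_lt p)) i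
    = cluster_height p D (rotate_lt p i)"
proof -
  let ?r = "rotate_lt p"
  let ?R = "\<lambda>E. map_prod ?r ?r ` E"
  have bij: "bij ?r"
    using rotate_lt_permutes by (rule permutes_bij)
  have "bij_betw ?R {E. E \<in> proper_equivs p \<and> cluster_point p E = i}
      {E. E \<in> proper_equivs p \<and> cluster_point p E = ?r i}"
  proof (rule bij_betw_imageI)
    show "inj_on ?R {E. E \<in> proper_equivs p \<and> cluster_point p E = i}"
      using bij by (intro inj_on_image) (auto intro: inj_on_subset[OF prod.inj_map] simp: bij_is_inj)
    have "E \<in> ?R ` {E. E \<in> proper_equivs p \<and> cluster_point p E = i}"
      if E: "E \<in> proper_equivs p" "cluster_point p E = ?r i" for E
    proof
      show eq: "E = ?R (inv_image E ?r)"
        using bij by (auto simp: map_prod_image_conv_inv_image inv_image_def bij_is_surj surj_f_inv_f)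
      have F: "inv_image E ?r \<in> proper_equivs p"
        using E(1) rotate_lt_permutes by (intro proper_equivs_inv_image)
      have "?r (cluster_point p (inv_image E ?r)) = ?r i"
        using cluster_point_rotate[OF assms F] eq E(2) by (simp add: map_prod_image_conv_inv_image[OF bij])
      with F show "inv_image E ?r \<in> {E. E \<in> proper_equivs p \<and> cluster_point p E = i}"
        using bij by (simp add: bij_is_inj inj_eq)
    qed
    then show "?R ` {E. E \<in> proper_equivs p \<and> cluster_point p E = i}
        = {E. E \<in> proper_equivs p \<and> cluster_point p E = ?r i}"
      using cluster_point_rotate[OF assms] proper_equivs_inv_image[OF permutes_inv[OF rotate_lt_permutes]]
      by (auto simp: map_prod_image_conv_inv_image[OF bij])
  qed
  then have "cluster_height p D (?r i) = (\<Sum>E | E \<in> proper_equivs p \<and> cluster_point p E = i. cluster_weight p D (?R E))"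
    unfolding cluster_height_def by (rule sum.reindex_bij_betw[symmetric])
  then show ?thesis
    by (simp add: cluster_height_def cluster_weight_map_prod rotate_lt_permutes)
qed

subsection \<open>The test map\<close>

text \<open>At zeros of \<open>\<delta>\<close> the product is squeezed by the absolute value of
  \<open>\<delta>\<close>; elsewhere both factors are continuous on an open set.\<close>

lemma continuous_on_mult_vanishing:
  fixes \<delta> \<phi> :: "'a::t2_space \<Rightarrow> real"
  assumes \<delta>: "continuous_on UNIV \<delta>" and \<phi>: "continuous_on {u. \<delta> u \<noteq> 0} \<phi>"
    and bound: "\<And>u. \<delta> u \<noteq> 0 \<Longrightarrow> \<bar>\<phi> u\<bar> \<le> 1"
  shows "continuous_on UNIV (\<lambda>u. \<delta> u * \<phi> u)"
proof -
  have "isCont (\<lambda>u. \<delta> u * \<phi> u) x" for x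
  proof (cases "\<delta> x = 0")
    case True
    have "(\<delta> \<longlongrightarrow> 0) (at x)"
      using \<delta> True unfolding continuous_on_def by (metis UNIV_I)
    then have "((\<lambda>u. \<bar>\<delta> u\<bar>) \<longlongrightarrow> 0) (at x)"
      by (rule tendsto_rabs_zero)
    moreover have "norm (\<delta> u * \<phi> u) \<le> \<bar>\<delta> u\<bar>" for u
      unfolding real_norm_def
      using bound[of u] mult_left_le[of "\<bar>\<phi> u\<bar>" "\<bar>\<delta> u\<bar>"]
      by (cases "\<delta> u = 0") (simp_all add: abs_mult)
    ultimately have "((\<lambda>u. \<delta> u * \<phi> u) \<longlongrightarrow> 0) (at x)"
      by (rule Lim_null_comparison[OF always_eventually[OF allI], rotated])
    with True show ?thesis
      by (simp add: isCont_def)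
  next
    case False
    have "open {u. \<delta> u \<noteq> 0}"
      using \<delta> by (intro open_Collect_neq continuous_on_const)
    with False \<phi> have "isCont \<phi> x"
      by (simp add: continuous_on_eq_continuous_at)
    moreover have "isCont \<delta> x"
      using \<delta> by (simp add: continuous_on_eq_continuous_at)
    ultimately show ?thesis
      by (intro continuous_mult)
  qed
  then show ?thesis
    by (simp add: continuous_on_eq_continuous_at)
qed

text \<open>A real sequence encodes a \<open>p\<close>-tuple of points: coordinate \<open>j\<close> of the point \<open>i\<close> sits at index
  \<open>p * j + i\<close>.\<close>

definition points :: "nat \<Rightarrow> nat \<Rightarrow> (nat \<Rightarrow> real) \<Rightarrow> nat \<Rightarrow> nat \<Rightarrow> real" where
  "points p d u = (\<lambda>i j. if i < p \<and> j < d then u (p * j + i) else 0)"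

definition rotate_index :: "nat \<Rightarrow> nat \<Rightarrow> nat" where
  "rotate_index p n = p * (n div p) + Suc n mod p"

lemma rotate_index_apply: "i < p \<Longrightarrow> rotate_index p (p * q + i) = p * q + Suc i mod p"
proof -
  assume "i < p"
  moreover have "Suc (p * q + i) mod p = Suc i mod p"
    using mod_mult_self4[of p q "Suc i"] by simp
  ultimately show ?thesis
    by (simp add: rotate_index_def)
qed

lemma funpow_rotate_index:
  assumes "0 < p"
  shows "(rotate_index p ^^ g) n = p * (n div p) + (n + g) mod p"
proof (induction g)
  case (Suc g)
  have "(rotate_index p ^^ Suc g) n = rotate_index p (p * (n div p) + (n + g) mod p)"
    using Suc by simp
  also have "\<dots> = p * (n div p) + Suc ((n + g) mod p) mod p"
    using assms by (intro rotate_index_apply) simp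
  finally show ?case
    by (simp add: mod_Suc_eq)
qed simp

lemma rotate_index_period: "0 < p \<Longrightarrow> rotate_index p ^^ p = id"
  by (rule ext) (simp add: funpow_rotate_index)

lemma points_rotate: "points p d (u \<circ> rotate_index p) = points p d u \<circ> rotate_lt p"
  by (rule ext)+ (simp add: points_def rotate_index_apply rotate_lt_def)

lemma points_in_tuples: "points p d u \<in> tuples p (Rn d)"
  by (auto simp: points_def tuples_def Rn_def)

lemma continuous_on_points: "continuous_on S (points p d)"
proof (rule continuous_on_coordinatewise_then_product, rule continuous_on_coordinatewise_then_product)
  fix i j
  have "continuous_on S (\<lambda>u::nat \<Rightarrow> real. u (p * j + i))"
    by (rule continuous_on_product_then_coordinatewise[OF continuous_on_id])
  then show "continuous_on S (\<lambda>u. points p d u i j)"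
    by (cases "i < p"; cases "j < d") (simp_all add: points_def)
qed

text \<open>The nonconstant tuples. Entries of \<open>u\<close> from index \<open>p * d\<close> on
  are arbitrary, which only adds a contractible factor.\<close>

definition spread :: "nat \<Rightarrow> nat \<Rightarrow> (nat \<Rightarrow> real) set" where
  "spread p d = {u. \<exists>i<p. \<exists>k<p. points p d u i \<noteq> points p d u k}"

definition point_dist :: "nat \<Rightarrow> nat \<Rightarrow> (nat \<Rightarrow> real) \<Rightarrow> nat \<times> nat \<Rightarrow> real" where
  "point_dist p d u a = (\<Sum>j<d. \<bar>points p d u (fst a) j - points p d u (snd a) j\<bar>)"

lemma point_dist_nonneg: "0 \<le> point_dist p d u a"
  by (simp add: point_dist_def sum_nonneg)

lemma point_dist_eq_0_iff:
  "point_dist p d u (i, k) = 0 \<longleftrightarrow> points p d u i = points p d u k"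
proof -
  have "point_dist p d u (i, k) = 0 \<longleftrightarrow> (\<forall>j<d. points p d u i j = points p d u k j)"
    by (auto simp: point_dist_def sum_nonneg_eq_0_iff)
  also have "\<dots> \<longleftrightarrow> points p d u i = points p d u k"
    by (auto simp: points_def fun_eq_iff)
  finally show ?thesis .
qed

lemma point_dist_rotate:
  "point_dist p d (u \<circ> rotate_index p) = point_dist p d u \<circ> map_prod (rotate_lt p) (rotate_lt p)"
  by (auto simp: point_dist_def points_rotate fun_eq_iff)

lemma continuous_on_point_dist: "continuous_on S (\<lambda>u. point_dist p d u a)"
proof -
  have "continuous_on S (\<lambda>u. points p d u i j)" for i j
    by (rule continuous_on_product_then_coordinatewise
        [OF continuous_on_product_then_coordinatewise[OF continuous_on_points]])
  then show ?thesis
    unfolding point_dist_def by (intro continuous_intros)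
qed

lemma rotate_lt_less_iff [simp]: "rotate_lt p i < p \<longleftrightarrow> i < p"
  using permutes_in_image[OF rotate_lt_permutes, of p i] by simp

lemma rotate_lt_eq_iff [simp]: "rotate_lt p i = rotate_lt p k \<longleftrightarrow> i = k"
  using permutes_inj[OF rotate_lt_permutes, of p] by (rule inj_eq)

definition discriminant :: "nat \<Rightarrow> nat \<Rightarrow> (nat \<Rightarrow> real) \<Rightarrow> real" where
  "discriminant p d u = (\<Prod>a\<in>{..<p} \<times> {..<p} - Id. point_dist p d u a)"

lemma discriminant_nonneg: "0 \<le> discriminant p d u"
  by (simp add: discriminant_def prod_nonneg point_dist_nonneg)

lemma discriminant_neq_0_iff: "discriminant p d u \<noteq> 0 \<longleftrightarrow> points p d u \<in> Conf p d"
proof -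
  have "discriminant p d u \<noteq> 0 \<longleftrightarrow> (\<forall>i<p. \<forall>k<p. i \<noteq> k \<longrightarrow> point_dist p d u (i, k) \<noteq> 0)"
    by (auto simp: discriminant_def)
  then show ?thesis
    by (simp add: Conf_def points_in_tuples point_dist_eq_0_iff)
qed

lemma discriminant_rotate: "discriminant p d (u \<circ> rotate_index p) = discriminant p d u"
proof -
  let ?r = "rotate_lt p"
  let ?R = "map_prod ?r ?r" and ?P = "{..<p} \<times> {..<p} - Id"
  have inj: "inj_on ?R ?P"
    by (rule inj_onI) auto
  moreover have "?R ` ?P \<subseteq> ?P"
    by auto
  ultimately have "?R ` ?P = ?P"
    by (intro endo_inj_surj) auto
  then have "discriminant p d u = (\<Prod>a\<in>?R ` ?P. point_dist p d u a)"
    by (simp add: discriminant_def)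
  also have "\<dots> = discriminant p d (u \<circ> rotate_index p)"
    by (simp add: discriminant_def prod.reindex[OF inj] point_dist_rotate)
  finally show ?thesis by simp
qed

lemma continuous_on_discriminant: "continuous_on S (discriminant p d)"
  unfolding discriminant_def by (intro continuous_intros continuous_on_point_dist)

text \<open>The first \<open>d - 1\<close> rows carry \<open>f\<close>, scaled to vanish at
  coincidences, where row \<open>d - 1\<close> takes over. Positions \<open>(i, j)\<close> name the
  label before the row, in contrast to the arguments of \<open>f\<close>.\<close>

definition test_map ::
  "nat \<Rightarrow> nat \<Rightarrow> ((nat \<Rightarrow> nat \<Rightarrow> real) \<Rightarrow> nat \<Rightarrow> nat \<Rightarrow> real) \<Rightarrow> (nat \<Rightarrow> real) \<Rightarrow> nat \<times> nat \<Rightarrow> real" where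
  "test_map p d f u = (\<lambda>(i, j). if j < d - 1 then discriminant p d u * f (points p d u) j i
    else cluster_height p (point_dist p d u) i)"

text \<open>The uniform bound that lets \<open>continuous_on_mult_vanishing\<close> apply.\<close>

lemma W_sphere_abs_le_1:
  assumes "v \<in> W_sphere p m"
  shows "\<bar>v j i\<bar> \<le> 1"
proof (cases "j < m \<and> i < p")
  case True
  have "(v j i)\<^sup>2 \<le> (\<Sum>i<p. v j i * v j i)"
    unfolding power2_eq_square using True by (intro member_le_sum[of i _ "\<lambda>i. v j i * v j i"]) auto
  also have "\<dots> \<le> (\<Sum>k<m. \<Sum>i<p. v k i * v k i)"
    using True by (intro member_le_sum[of j _ "\<lambda>k. \<Sum>i<p. v k i * v k i"]) (auto intro: sum_nonneg)
  also have "\<dots> = 1"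
    using assms by (simp add: W_sphere_def W_inner_def)
  finally show ?thesis
    by (simp add: abs_square_le_1)
next
  case False
  then have "v j i = 0"
    using assms by (cases "j < m") (auto simp: W_sphere_def W_sum_def tuples_def W_def Rn_def)
  then show ?thesis by simp
qed

lemma continuous_on_test_map:
  assumes "equivariant_map p d f"
  shows "continuous_on UNIV (\<lambda>u. test_map p d f u l)"
proof -
  obtain i j where l: "l = (i, j)" by (cases l)
  have f: "continuous_on (Conf p d) f" "f \<in> Conf p d \<rightarrow> W_sphere p (d - 1)"
    using assms by (auto simp: equivariant_map_def)
  have "continuous_on {u. discriminant p d u \<noteq> 0} (\<lambda>u. f (points p d u))"
    by (rule continuous_on_compose2[OF f(1) continuous_on_points]) (auto simp: discriminant_neq_0_iff)
  then have "continuous_on {u. discriminant p d u \<noteq> 0} (\<lambda>u. f (points p d u) j i)"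
    by (rule continuous_on_product_then_coordinatewise[OF continuous_on_product_then_coordinatewise])
  then have "continuous_on UNIV (\<lambda>u. discriminant p d u * f (points p d u) j i)"
    using f(2) by (intro continuous_on_mult_vanishing continuous_on_discriminant W_sphere_abs_le_1[of _ p "d - 1"])
      (auto simp: discriminant_neq_0_iff)
  then show ?thesis
    using continuous_on_cluster_height[of UNIV "point_dist p d" p i] continuous_on_point_dist
    by (cases "j < d - 1") (simp_all add: l test_map_def)
qed

lemma test_map_rotate:
  assumes "equivariant_map p d f" "prime p"
  shows "test_map p d f (u \<circ> rotate_index p) (i, j) = test_map p d f u (rotate_lt p i, j)"
proof -
  \<comment> \<open>\<open>perm_act\<close> composes with the inverse permutation, so composing with
    the rotation is the action of its inverse.\<close>
  let ?\<sigma> = "inv_into UNIV (rotate_lt p)"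
  have \<sigma>: "?\<sigma> permutes {..<p}" "inv_into UNIV ?\<sigma> = rotate_lt p"
    using rotate_lt_permutes by (auto intro: permutes_inv permutes_inv_inv)
  have act: "points p d (u \<circ> rotate_index p) = perm_act ?\<sigma> (points p d u)"
    unfolding points_rotate by (simp add: perm_act_def \<sigma>(2) comp_def)
  have "discriminant p d u * f (points p d (u \<circ> rotate_index p)) j i
      = discriminant p d u * f (points p d u) j (rotate_lt p i)"
  proof (cases "discriminant p d u = 0")
    case False
    then have "f (points p d (u \<circ> rotate_index p)) = diag_act ?\<sigma> (f (points p d u))"
      using assms(1) \<sigma>(1) unfolding act by (simp add: equivariant_map_def discriminant_neq_0_iff)
    then show ?thesis
      by (simp add: diag_act_def perm_act_def \<sigma>(2))
  qed simp
  then show ?thesis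
    by (simp add: test_map_def discriminant_rotate point_dist_rotate cluster_height_rotate[OF assms(2)])
qed

text \<open>At a configuration, some summand of \<open>f\<close> is nonzero with coordinate sum 0
  and so has a positive entry. Otherwise the coincidences form a nontrivial partition, and a cluster
  height is positive.\<close>

lemma test_map_pos:
  assumes f: "equivariant_map p d f" and "prime p" "1 \<le> d" and u: "u \<in> spread p d"
  shows "\<exists>i<p. \<exists>j<d. 0 < test_map p d f u (i, j)"
proof (cases "points p d u \<in> Conf p d")
  case True
  then have v: "f (points p d u) \<in> W_sphere p (d - 1)"
    using f by (auto simp: equivariant_map_def)
  let ?v = "f (points p d u)"
  have "\<exists>j<d - 1. \<exists>i<p. ?v j i \<noteq> 0"
  proof (rule ccontr)
    assume "\<not> ?thesis"
    then have "W_inner p (d - 1) ?v ?v = 0"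
      by (simp add: W_inner_def)
    with v show False by (simp add: W_sphere_def)
  qed
  then obtain j i where j: "j < d - 1" "i < p" "?v j i \<noteq> 0"
    by blast
  have sum: "(\<Sum>i<p. ?v j i) = 0"
    using v j(1) by (simp add: W_sphere_def W_sum_def tuples_def W_def)
  have "\<exists>i<p. 0 < ?v j i"
  proof (rule ccontr)
    assume "\<not> ?thesis"
    then have "?v j i \<le> 0" if "i < p" for i
      using that by (meson not_less)
    then have "\<forall>i\<in>{..<p}. - ?v j i \<ge> 0"
      by simp
    moreover have "(\<Sum>i<p. - ?v j i) = 0"
      using sum by (simp add: sum_negf)
    ultimately have "\<forall>i\<in>{..<p}. - ?v j i = 0"
      using sum_nonneg_eq_0_iff[of "{..<p}" "\<lambda>i. - ?v j i"] by simp
    with j show False by simp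
  qed
  then obtain i where "i < p" "0 < ?v j i" by blast
  moreover have "0 < discriminant p d u"
    using True discriminant_nonneg[of p d u] by (simp add: less_le flip: discriminant_neq_0_iff)
  ultimately have "0 < test_map p d f u (i, j)"
    using j(1) by (simp add: test_map_def)
  moreover have "j < d"
    using j(1) by simp
  ultimately show ?thesis
    using \<open>i < p\<close> by blast
next
  case False
  let ?E = "{a \<in> {..<p} \<times> {..<p}. point_dist p d u a = 0}"
  have E_iff: "(i, k) \<in> ?E \<longleftrightarrow> i < p \<and> k < p \<and> points p d u i = points p d u k" for i k
    by (simp add: point_dist_eq_0_iff)
  have equiv: "equiv {..<p} ?E"
  proof (rule equivI)
    show "refl_on {..<p} ?E"
      by (rule refl_onI) (simp add: E_iff del: mem_Collect_eq)
    show "sym ?E"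
      by (rule symI) (simp add: E_iff del: mem_Collect_eq)
    show "trans ?E"
      by (rule transI) (simp add: E_iff del: mem_Collect_eq)
  qed blast
  obtain i k where ik: "i < p" "k < p" "points p d u i \<noteq> points p d u k"
    using u by (auto simp: spread_def)
  then have "(i, k) \<notin> ?E"
    unfolding E_iff by simp
  with ik(1,2) have not_full: "?E \<noteq> {..<p} \<times> {..<p}" by blast
  obtain i' k' where ik': "i' < p" "k' < p" "i' \<noteq> k'" "points p d u i' = points p d u k'"
    using False by (auto simp: Conf_def points_in_tuples)
  then have "(i', k') \<in> ?E"
    unfolding E_iff by simp
  moreover have "(i', k') \<notin> Id_on {..<p}"
    using ik'(3) by auto
  ultimately have "?E \<noteq> Id_on {..<p}"
    by metis
  with equiv not_full have "?E \<in> proper_equivs p"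
    by (simp add: proper_equivs_def)
  from cluster_height_pos[OF point_dist_nonneg this prime_gt_0_nat[OF assms(2)]]
  obtain i where "i < p" "0 < cluster_height p (point_dist p d u) i" by blast
  then have "i < p" "0 < test_map p d f u (i, d - 1)"
    by (simp_all add: test_map_def)
  moreover have "d - 1 < d"
    using assms(3) by simp
  ultimately show ?thesis
    by blast
qed

lemma card_Collect_less:
  fixes p :: nat
  assumes "i < p" "\<not> P i"
  shows "card {i. i < p \<and> P i} < p"
proof -
  have "{i. i < p \<and> P i} \<subset> {..<p}"
    using assms by blast
  from psubset_card_mono[OF _ this] show ?thesis
    by simp
qed

text \<open>A row with sum 0 cannot be entirely positive, so each of the first \<open>d - 1\<close>
  rows has at most \<open>p - 1\<close> positive entries; the last has at most \<open>p - 2\<close>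
  by clustering.\<close>

lemma card_test_map_pos:
  assumes f: "equivariant_map p d f" and "prime p" "1 \<le> d"
  shows "j < d \<Longrightarrow> card {i. i < p \<and> 0 < test_map p d f u (i, j)} < p"
    and "card {(i, j). i < p \<and> j < d \<and> 0 < test_map p d f u (i, j)} \<le> d * (p - 1) - 1"
proof -
  let ?S = "\<lambda>j. {i. i < p \<and> 0 < test_map p d f u (i, j)}"
  have p: "2 \<le> p" using assms(2) by (rule prime_ge_2_nat)
  have row: "card (?S j) \<le> p - 1" if "j < d - 1" for j
  proof -
    have "\<exists>i<p. \<not> 0 < test_map p d f u (i, j)"
    proof (rule ccontr)
      assume "\<not> ?thesis"
      then have pos: "0 < discriminant p d u * f (points p d u) j i" if "i < p" for i
        using that \<open>j < d - 1\<close> by (simp add: test_map_def)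
      then have "discriminant p d u \<noteq> 0"
        using p by fastforce
      then have "f (points p d u) \<in> W_sphere p (d - 1)"
        using f by (auto simp: discriminant_neq_0_iff equivariant_map_def)
      then have "(\<Sum>i<p. f (points p d u) j i) = 0"
        using that by (simp add: W_sphere_def W_sum_def tuples_def W_def)
      then have "(\<Sum>i<p. discriminant p d u * f (points p d u) j i) = 0"
        by (simp flip: sum_distrib_left)
      moreover have "0 < (\<Sum>i<p. discriminant p d u * f (points p d u) j i)"
        using pos p(1) by (intro sum_pos) (auto simp: lessThan_empty_iff bot_nat_def)
      ultimately show False by simp
    qed
    then obtain i where "i < p" "\<not> 0 < test_map p d f u (i, j)"
      by blast
    with card_Collect_less[of i p "\<lambda>i. 0 < test_map p d f u (i, j)"] show ?thesis
      by simp
  qed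
  have last: "card (?S (d - 1)) \<le> p - 2"
  proof -
    have "?S (d - 1) \<subseteq> {i. cluster_height p (point_dist p d u) i \<noteq> 0}"
      by (auto simp: test_map_def)
    then have "card (?S (d - 1)) \<le> card {i. cluster_height p (point_dist p d u) i \<noteq> 0}"
      using p by (intro card_mono card_cluster_height_support) auto
    also have "\<dots> \<le> p - 2"
      using p by (intro card_cluster_height_support) auto
    finally show ?thesis .
  qed
  show "card (?S j) < p" if "j < d"
  proof (cases "j = d - 1")
    case True
    then show ?thesis using last p by simp
  next
    case False
    then have "j < d - 1" using that by linarith
    then show ?thesis using row[of j] p by simp
  qed
  have eq: "{(i, j). i < p \<and> j < d \<and> 0 < test_map p d f u (i, j)} = (\<lambda>(j, i). (i, j)) ` (SIGMA j:{..<d}. ?S j)"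
    by auto
  have "card {(i, j). i < p \<and> j < d \<and> 0 < test_map p d f u (i, j)} \<le> card (SIGMA j:{..<d}. ?S j)"
    unfolding eq by (rule card_image_le) simp
  also have "\<dots> = (\<Sum>j<Suc (d - 1). card (?S j))"
    using assms(3) by simp
  also have "\<dots> \<le> (\<Sum>j<d - 1. p - 1) + (p - 2)"
    unfolding sum.lessThan_Suc using row last by (intro add_mono sum_mono) auto
  also have "\<dots> = d * (p - 1) - 1"
    using p assms(3) by (cases d) (auto simp: algebra_simps)
  finally show "card {(i, j). i < p \<and> j < d \<and> 0 < test_map p d f u (i, j)} \<le> d * (p - 1) - 1" .
qed

text \<open>
  For each row \<open>j < d\<close> there are \<open>p - 1\<close> consecutive values of \<open>k\<close>, whose vertices are the unit vectors of row
  \<open>j\<close> up to rotation. A convex combination of one vertex for each \<open>k\<close> thus misses a coordinate in every row.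
\<close>

definition join_vertex :: "nat \<Rightarrow> nat \<Rightarrow> nat \<Rightarrow> real" where
  "join_vertex p k n = (if n = p * (k div (p - 1)) then 1 else 0)"

section \<open>Simplices of the join avoid the constant tuples\<close>

lemma mod_add_eq_0_iff:
  fixes i p g :: nat
  assumes "i < p"
  shows "(i + g) mod p = 0 \<longleftrightarrow> i = (p - g mod p) mod p"
proof -
  let ?a = "g mod p"
  have a: "?a < p" using assms by simp
  have "(i + g) mod p = (i + ?a) mod p"
    by (simp add: mod_add_right_eq)
  also have "\<dots> = 0 \<longleftrightarrow> i = (p - ?a) mod p"
  proof (cases "?a = 0")
    case True
    then show ?thesis using assms by simp
  next
    case False
    then have "(p - ?a) mod p = p - ?a"
      using assms by simp
    moreover have "(i + ?a) mod p = (if i + ?a < p then i + ?a else i + ?a - p)"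
    proof (cases "i + ?a < p")
      case False
      moreover have "i + ?a - p < p"
        using assms a by linarith
      ultimately show ?thesis
        by (simp add: le_mod_geq)
    qed simp
    ultimately show ?thesis
      using False a by auto
  qed
  finally show ?thesis .
qed

text \<open>Rotating a unit vector gives a unit vector in the same row;
  \<open>(p - g mod p) mod p\<close> is the residue of \<open>-g\<close>.\<close>

lemma join_vertex_rotate:
  assumes "i < p"
  shows "join_vertex p k ((rotate_index p ^^ g) (p * r + i))
    = (if r = k div (p - 1) \<and> i = (p - g mod p) mod p then 1 else 0)"
proof -
  have "p * r + (i + g) mod p = p * q \<longleftrightarrow> r = q \<and> (i + g) mod p = 0" for q
  proof
    assume eq: "p * r + (i + g) mod p = p * q"
    have "(p * r + (i + g) mod p) div p = r" "(p * r + (i + g) mod p) mod p = (i + g) mod p"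
      using assms by auto
    with eq show "r = q \<and> (i + g) mod p = 0"
      using assms by auto
  qed auto
  moreover have "(p * r + i + g) mod p = (i + g) mod p"
    by (metis add.assoc mod_mult_self4)
  ultimately show ?thesis
    using assms by (simp add: join_vertex_def funpow_rotate_index mod_add_eq_0_iff)
qed

text \<open>Take the row \<open>r\<close> of a vertex with nonzero weight. At most
  \<open>p - 1\<close> vertices lie in this row, so one of its \<open>p\<close> coordinates vanishes
  while another is positive, and the two corresponding points differ.\<close>

lemma join_simplex_spread:
  assumes "2 \<le> p" "k < d * (p - 1)" and \<sigma>: "\<sigma> \<in> join_simplices (rotate_index p) (join_vertex p) k"
    and x: "x \<in> standard_simplex k"
  shows "\<sigma> x \<in> spread p d"
proof -
  from \<sigma> obtain l where \<sigma>_eq: "\<sigma> = oriented_simplex k l"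
    and "\<forall>j\<le>k. \<exists>g. l j = join_vertex p (k - j) \<circ> (rotate_index p ^^ g)"
    by (auto simp: join_simplices_def)
  then obtain g where l: "\<And>j. j \<le> k \<Longrightarrow> l j = join_vertex p (k - j) \<circ> (rotate_index p ^^ g j)"
    by metis
  define h where "h j = (p - g j mod p) mod p" for j
  have \<sigma>x: "\<sigma> x (p * r + i) = (\<Sum>j\<le>k. if r = (k - j) div (p - 1) \<and> i = h j then x j else 0)" if "i < p" for r i
    using x that unfolding \<sigma>_eq oriented_simplex_def
    by (auto simp: l join_vertex_rotate h_def intro!: sum.cong)
  have x_ge: "0 \<le> x j" for j
    using x by (simp add: standard_simplex_def)
  have x_sum: "(\<Sum>j\<le>k. x j) = 1"
    using x by (simp add: standard_simplex_def)
  have "\<exists>j\<le>k. x j \<noteq> 0"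
  proof (rule ccontr)
    assume "\<not> ?thesis"
    then have "(\<Sum>j\<le>k. x j) = 0" by (intro sum.neutral) auto
    with x_sum show False by simp
  qed
  then obtain j where j: "j \<le> k" "x j \<noteq> 0" by blast
  define r where "r = (k - j) div (p - 1)"
  have "r < d"
    using assms(1,2) by (simp add: r_def div_less_iff_less_mult)
  let ?J = "{m. m \<le> k \<and> (k - m) div (p - 1) = r}"
  have "q \<in> {r * (p - 1)..<r * (p - 1) + (p - 1)}" if "q div (p - 1) = r" for q
  proof -
    have "q < p - 1 + q div (p - 1) * (p - 1)"
      using assms(1) by (intro dividend_less_div_times) simp
    with div_times_less_eq_dividend[of q "p - 1"] show ?thesis
      unfolding that atLeastLessThan_iff by (simp only: add.commute)
  qed
  then have "(\<lambda>m. k - m) ` ?J \<subseteq> {r * (p - 1)..<r * (p - 1) + (p - 1)}"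
    by blast
  then have "card ((\<lambda>m. k - m) ` ?J) \<le> p - 1"
    using card_mono[of "{r * (p - 1)..<r * (p - 1) + (p - 1)}"] by simp
  moreover have "inj_on (\<lambda>m. k - m) {..k}"
    by (rule inj_onI) simp
  then have "inj_on (\<lambda>m. k - m) ?J"
    by (rule inj_on_subset) blast
  ultimately have "card ?J \<le> p - 1"
    by (simp add: card_image)
  moreover have "finite ?J"
    by simp
  ultimately have "card (h ` ?J) < p"
    using card_image_le[of ?J h] assms(1) by linarith
  moreover have "p \<le> card (h ` ?J)" if "{..<p} \<subseteq> h ` ?J"
    using card_mono[OF finite_imageI[OF \<open>finite ?J\<close>] that] by simp
  ultimately have "\<not> {..<p} \<subseteq> h ` ?J"
    using leD by blast
  then obtain i where i: "i < p" "i \<notin> h ` ?J" by auto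
  have zero: "\<sigma> x (p * r + i) = 0"
    unfolding \<sigma>x[OF i(1)] using i(2) by (intro sum.neutral) auto
  have hj: "h j < p"
    using assms(1) by (simp add: h_def)
  have "0 < (if r = (k - j) div (p - 1) \<and> h j = h j then x j else 0)"
    using j x_ge[of j] by (simp add: r_def)
  also have "\<dots> \<le> \<sigma> x (p * r + h j)"
    unfolding \<sigma>x[OF hj] using j(1) x_ge
    by (intro member_le_sum[of j _ "\<lambda>m. if r = (k - m) div (p - 1) \<and> h j = h m then x m else 0"]) auto
  finally have "0 < \<sigma> x (p * r + h j)" .
  with zero have "points p d (\<sigma> x) i r \<noteq> points p d (\<sigma> x) (h j) r"
    using i(1) hj \<open>r < d\<close> by (simp add: points_def)
  then have "points p d (\<sigma> x) i \<noteq> points p d (\<sigma> x) (h j)"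
    by auto
  then show ?thesis
    unfolding spread_def using i(1) hj by blast
qed

text \<open>
  The label set of \<open>u\<close> consists of the positions where the test map is maximal. It shrinks near \<open>u\<close>,
  which makes it simplicial on small simplices.
\<close>

theorem theorem4p7:
  fixes p d :: nat
  assumes "prime p" and "d \<ge> 1"
  shows "\<not> (\<exists>f. equivariant_map p d f)"
proof
  assume "\<exists>f. equivariant_map p d f"
  then obtain f where f: "equivariant_map p d f" ..
  have p: "2 \<le> p" "0 < p"
    using prime_ge_2_nat[OF assms(1)] by auto
  \<comment> \<open>\<open>Suc N\<close> is \<open>d * (p - 1)\<close>, so the degrees
    \<open>k \<le> N\<close> are those covered by \<open>join_simplex_spread\<close>.\<close>
  define N where "N = d * (p - 1) - 1"
  let ?r = "rotate_lt p" and ?t = "\<lambda>u::nat \<Rightarrow> real. u \<circ> rotate_index p"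
  let ?\<sigma> = "inv_into UNIV (rotate_lt p)"
  let ?X = "subtopology (powertop_real UNIV) (spread p d)"
  let ?b = "join_chain p (rotate_index p) (join_vertex p)"
  let ?\<Psi> = "test_map p d f"
  define L where "L = {..<p} \<times> {..<d}"
  define A where "A u = {l \<in> L. \<forall>m\<in>L. ?\<Psi> u m \<le> ?\<Psi> u l}" for u
  \<comment> \<open>The test map at \<open>?t u\<close> takes at a position the value that it has
    for \<open>u\<close> at the rotated position, so the maxima move by the inverse
    rotation.\<close>
  define \<tau> where "\<tau> = map_prod ?\<sigma> (id :: nat \<Rightarrow> nat)"
  define row where "row B j = {i. (i, j) \<in> B}" for B :: "(nat \<times> nat) set" and j
  \<comment> \<open>Positions with positive values never fill a row, so the first nonempty row of a
    nonempty set of them is a proper subset of \<open>{..<p}\<close>, as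
    \<open>cyclic_mean_shift\<close> requires.\<close>
  define first_row where "first_row B = row B (LEAST j. row B j \<noteq> {})" for B
  have r_inv: "?\<sigma> (?r i) = i" "?r (?\<sigma> i) = i" for i
    using permutes_inverses[OF rotate_lt_permutes] by auto
  have r_lt: "?r i < p \<longleftrightarrow> i < p" "?\<sigma> i < p \<longleftrightarrow> i < p" for i
    using permutes_in_image[OF permutes_inv[OF rotate_lt_permutes], of p i] by auto
  have A_pos: "A u \<subseteq> {(i, j). i < p \<and> j < d \<and> 0 < ?\<Psi> u (i, j)}" if "u \<in> spread p d" for u
  proof
    fix l assume l: "l \<in> A u"
    from test_map_pos[OF f assms that] obtain m where "m \<in> L" "0 < ?\<Psi> u m"
      by (auto simp: L_def)
    with l have "0 < ?\<Psi> u l" "l \<in> L"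
      by (force simp: A_def)+
    then show "l \<in> {(i, j). i < p \<and> j < d \<and> 0 < ?\<Psi> u (i, j)}"
      by (auto simp: L_def)
  qed
  have A_t: "A (?t u) = \<tau> ` A u" for u
  proof -
    have \<Psi>_t: "?\<Psi> (?t u) l = ?\<Psi> u (map_prod ?r id l)" for l
      by (cases l) (simp add: test_map_rotate[OF f assms(1)])
    have L_r: "map_prod ?r id l \<in> L \<longleftrightarrow> l \<in> L" "\<tau> l \<in> L \<longleftrightarrow> l \<in> L" for l
      by (cases l; simp add: L_def \<tau>_def r_lt)+
    have inv: "map_prod ?r id (\<tau> l) = l" "\<tau> (map_prod ?r id l) = l" for l
      by (cases l; simp add: \<tau>_def r_inv)+
    have mem: "l \<in> A (?t u) \<longleftrightarrow> map_prod ?r id l \<in> A u" for l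
    proof -
      have "(\<forall>m\<in>L. ?\<Psi> u (map_prod ?r id m) \<le> c) \<longleftrightarrow> (\<forall>m\<in>L. ?\<Psi> u m \<le> c)" for c
        using L_r inv by metis
      then show ?thesis
        by (simp add: A_def \<Psi>_t L_r)
    qed
    show ?thesis
    proof (intro equalityI subsetI)
      fix l assume "l \<in> A (?t u)"
      then show "l \<in> \<tau> ` A u"
        using mem inv(2)[of l] by (intro image_eqI[of _ _ "map_prod ?r id l"]) auto
    next
      fix l assume "l \<in> \<tau> ` A u"
      then obtain m where "l = \<tau> m" "m \<in> A u" by blast
      then show "l \<in> A (?t u)"
        by (simp add: mem inv)
    qed
  qed
  show False
  \<comment> \<open>The minus sign is needed since \<open>\<tau>\<close> lowers the cyclic mean by
    1.\<close>
  proof (rule no_small_equivariant_labelling[of p ?X ?t N ?b _ A \<tau> "\<lambda>B. - cyclic_mean p (first_row B)"])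
    show "1 < p" using p by simp
    have "continuous_map (powertop_real UNIV) (powertop_real UNIV) ?t"
      by (auto simp: continuous_map_componentwise intro: continuous_map_product_projection)
    moreover have "?t u \<in> spread p d" if "u \<in> spread p d" for u
    proof -
      have t: "points p d (?t u) (?\<sigma> i) = points p d u i" for i
        by (simp only: points_rotate comp_apply r_inv)
      from that obtain i k where "i < p" "k < p" "points p d u i \<noteq> points p d u k"
        by (auto simp: spread_def)
      then have "?\<sigma> i < p \<and> ?\<sigma> k < p \<and> points p d (?t u) (?\<sigma> i) \<noteq> points p d (?t u) (?\<sigma> k)"
        by (simp only: t r_lt simp_thms)
      then show ?thesis
        unfolding spread_def by blast
    qed
    ultimately show "continuous_map ?X ?X ?t"
      by (auto simp: continuous_map_in_subtopology continuous_map_from_subtopology)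
    show "singular_chain k ?X (?b k)" if "k \<le> N" for k
      unfolding singular_chain_subtopology
    proof (intro conjI ballI singular_chain_join_chain)
      have "k < d * (p - 1)"
        using that p assms(2) by (cases "d * (p - 1)") (auto simp: N_def)
      then show "\<sigma> ` standard_simplex k \<subseteq> spread p d" if "\<sigma> \<in> Poly_Mapping.keys (?b k)" for \<sigma>
        using join_simplex_spread[OF p(1)] keys_join_chain that by blast
    qed
    show "?b 0 = frag_of (oriented_simplex 0 (\<lambda>_. join_vertex p 0))"
      by simp
    show "chain_boundary (Suc k) (?b (Suc k)) = periodic_boundary p ?t k (?b k)" for k
      using chain_boundary_join_chain[OF rotate_index_period[OF p(2)]] .
    show "openin ?X {y \<in> topspace ?X. A y \<subseteq> A x}" for x
    proof -
      \<comment> \<open>A position fails to be maximal exactly if another one strictly exceeds it.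
        Inclusion in \<open>A x\<close> thus amounts to finitely many open conditions.\<close>
      have not_A: "l \<notin> A y \<longleftrightarrow> (\<exists>m\<in>L. ?\<Psi> y l < ?\<Psi> y m)" if "l \<in> L" for l y
        using that by (simp add: A_def not_le)
      have "A y \<subseteq> A x \<longleftrightarrow> (\<forall>l\<in>L - A x. l \<notin> A y)" for y
      proof -
        have "A y \<subseteq> L" by (auto simp: A_def)
        then show ?thesis by blast
      qed
      then have "A y \<subseteq> A x \<longleftrightarrow> (\<forall>l\<in>L - A x. \<exists>m\<in>L. ?\<Psi> y l < ?\<Psi> y m)" for y
        using not_A by simp
      then have "{y. A y \<subseteq> A x} = (\<Inter>l\<in>L - A x. \<Union>m\<in>L. {y. ?\<Psi> y l < ?\<Psi> y m})"
        by (simp add: set_eq_iff)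
      moreover have "open (\<Inter>l\<in>L - A x. \<Union>m\<in>L. {y. ?\<Psi> y l < ?\<Psi> y m})"
        by (intro open_INT open_UN ballI open_Collect_less continuous_on_test_map[OF f]) (simp add: L_def)
      ultimately have "openin (powertop_real UNIV) {y. A y \<subseteq> A x}"
        by (simp add: euclidean_product_topology)
      then show ?thesis
        by (auto simp: openin_subtopology)
    qed
    show "finite (A x) \<and> A x \<noteq> {} \<and> card (A x) \<le> N" if "x \<in> topspace ?X" for x
    proof (intro conjI)
      have x: "x \<in> spread p d" using that by simp
      have "(0, 0) \<in> L"
        using p assms(2) by (simp add: L_def)
      then have fin: "finite L" "L \<noteq> {}"
        by (auto simp: L_def)
      show "finite (A x)" using fin by (simp add: A_def)
      have "Max (?\<Psi> x ` L) \<in> ?\<Psi> x ` L"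
        using fin by (intro Max_in) auto
      then obtain l where "l \<in> L" "?\<Psi> x l = Max (?\<Psi> x ` L)" by auto
      then have "l \<in> A x" using fin by (auto simp: A_def)
      then show "A x \<noteq> {}" by blast
      have "finite {(i, j). i < p \<and> j < d \<and> 0 < ?\<Psi> x (i, j)}"
        by (rule finite_subset[OF _ fin(1)]) (auto simp: L_def)
      then show "card (A x) \<le> N"
        using card_mono[OF _ A_pos[OF x]] card_test_map_pos(2)[OF f assms, of x] by (simp add: N_def)
    qed
    show "A (?t x) = \<tau> ` A x" for x
      by (rule A_t)
    show "[- cyclic_mean p (first_row (\<tau> ` B)) = - cyclic_mean p (first_row B) + 1] (mod int p)"
      if x: "x \<in> topspace ?X" and B: "B \<subseteq> A x" "B \<noteq> {}" for x B
    proof -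
      have row_\<tau>: "row (\<tau> ` B) j = ?\<sigma> ` row B j" for j
        by (force simp: row_def \<tau>_def image_iff)
      define j where "j = (LEAST j. row B j \<noteq> {})"
      have "\<exists>j. row B j \<noteq> {}"
        using B(2) by (auto simp: row_def)
      then have ne: "row B j \<noteq> {}"
        unfolding j_def by (rule LeastI_ex)
      then obtain i where "(i, j) \<in> B" by (auto simp: row_def)
      with A_pos B(1) x have "j < d" by auto
      have sub: "row B j \<subseteq> {i. i < p \<and> 0 < ?\<Psi> x (i, j)}"
        using A_pos B(1) x by (auto simp: row_def)
      have "card (row B j) \<le> card {i. i < p \<and> 0 < ?\<Psi> x (i, j)}"
        using sub by (intro card_mono) auto
      also have "\<dots> < p"
        using card_test_map_pos(1)[OF f assms \<open>j < d\<close>] .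
      finally have "row B j \<subset> {..<p}"
        using sub by auto
      then have "[cyclic_mean p (?\<sigma> ` row B j) = cyclic_mean p (row B j) + (- 1)] (mod int p)"
      proof (rule cyclic_mean_shift[OF assms(1) _ ne])
        show "inj_on ?\<sigma> (row B j)"
          using r_inv(2) by (metis inj_onI)
        show "[int (?\<sigma> i) = int i + - 1] (mod int p)" if "i \<in> row B j" for i
        proof -
          have "i < p" using sub that by auto
          then have "[int i = int (?\<sigma> i) + 1] (mod int p)"
            using cong_rotate_lt[of "?\<sigma> i" p] by (simp add: r_lt r_inv)
          then show ?thesis
            by (simp add: cong_iff_dvd_diff algebra_simps dvd_diff_commute)
        qed
      qed
      then have "[- cyclic_mean p (?\<sigma> ` row B j) = - cyclic_mean p (row B j) + 1] (mod int p)"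
        using cong_minus_minus_iff by fastforce
      moreover have "first_row (\<tau> ` B) = ?\<sigma> ` row B j" "first_row B = row B j"
        by (simp_all add: first_row_def row_\<tau> j_def)
      ultimately show ?thesis
        by simp
    qed
  qed
qed

end
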